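(* Let $d\ge 1$, let $t_0<t_1$ be real numbers, and let $\gamma:[t_0,t_1]\to\mathbb{R}^d$ be a rectifiable reduced path. Then the log-signature $\operatorname{logSig}(\gamma)$ is a Lie polynomial if and only if $\gamma$ is a straight line up to reparametrisation and translation, i.e. if and only if there exist $a,b\in\mathbb{R}^d$ and an increasing bijection $\tau:[t_0,t_1]\to[0,1]$ such that $\gamma(t)=\tau(t)\,a+b$ for all $t\in[t_0,t_1]$.
   Context: A path $\gamma:[t_0,t_1]\to\mathbb{R}^d$ is rectifiable if it is continuous and of bounded variation. Let $T((\mathbb{R}^d))=\prod_{k\ge 0}(\mathbb{R}^d)^{\otimes k}$ be the algebra of tensor series over $\mathbb{R}^d$ with product $\otimes$ (isomorphic to formal power series in $d$ non-commuting indeterminates), and let $\pi_k$ be the projection onto $(\mathbb{R}^d)^{\otimes k}$. Signature: for a rectifiable path $\gamma:[t_0,t_1]\to\mathbb{R}^d$, $\operatorname{Sig}(\gamma):=\mathbf{S}(t_1)\in T((\mathbb{R}^d))$, where $\mathbf{S}$ solves $d\mathbf{S}=\mathbf{S}\otimes d\gamma$, $\mathbf{S}(t_0)=1$. Equivalently, $\pi_0(\operatorname{Sig}(\gamma))=1$ and, for $k\ge1$, the coefficient of $\pi_k(\operatorname{Sig}(\gamma))$ at position $(i_1,\dots,i_k)$ is the iterated Riemann–Stieltjes integral $\int_{t_0<s_1<\cdots<s_k<t_1} d\gamma_{i_1}(s_1)\cdots d\gamma_{i_k}(s_k)$. The signature of a restriction $\gamma|_{[s_0,s_1]}$ is defined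 in the same way. Log-signature: $\operatorname{logSig}(\gamma):=\log(\operatorname{Sig}(\gamma))$, where $\log(1+S)=\sum_{k\ge1}\frac{(-1)^{k-1}}{k}S^{\otimes k}$ for $S$ with zero constant term. With the bracket $[v,w]=v\otimes w-w\otimes v$, the space of Lie series $L((\mathbb{R}^d))\subset T((\mathbb{R}^d))$ consists of the tensor series whose level-$0$ component is $0$ and whose level-$k$ component, for every $k\ge 1$, is a linear combination of $k$-fold iterated brackets of elements of $\mathbb{R}^d$. The log-signature of a rectifiable path is always a Lie series (Chen). A Lie polynomial is a Lie series with only finitely many non-zero homogeneous components. A rectifiable path $\gamma:[t_0,t_1]\to\mathbb{R}^d$ is reduced if there is no interval $[s_0,s_1]\subset[t_0,t_1]$ with $s_0<s_1$ such that $\operatorname{Sig}(\gamma|_{[s_0,s_1]})=1$. Equivalently, $t\mapsto\operatorname{Sig}(\gamma|_{[t_0,t]})$ is injective. *)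

theory Defs
  imports "HOL-Analysis.Analysis"
begin

section \<open>Tensor series\<close>

text \<open>A tensor series over \<open>real ^ 'd\<close> is given by its coefficients: the level \<open>k\<close> component
  has, at position \<open>(i\<^sub>1, \<dots>, i\<^sub>k)\<close>, the value of the function at the word \<open>[i\<^sub>1, \<dots>, i\<^sub>k]\<close>.\<close>

type_synonym 'd tensor_series = "'d list \<Rightarrow> real"

definition tzero :: "'d tensor_series" where
  "tzero = (\<lambda>w. 0)"

definition tone :: "'d tensor_series" where
  "tone = (\<lambda>w. if w = [] then 1 else 0)"

definition tminus :: "'d tensor_series \<Rightarrow> 'd tensor_series \<Rightarrow> 'd tensor_series" where
  "tminus A B = (\<lambda>w. A w - B w)"

definition tprod :: "'d tensor_series \<Rightarrow> 'd tensor_series \<Rightarrow> 'd tensor_series" where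
  "tprod A B = (\<lambda>w. \<Sum>n\<le>length w. A (take n w) * B (drop n w))"

primrec tpow :: "'d tensor_series \<Rightarrow> nat \<Rightarrow> 'd tensor_series" where
  "tpow A 0 = tone"
| "tpow A (Suc n) = tprod A (tpow A n)"

definition tproj :: "nat \<Rightarrow> 'd tensor_series \<Rightarrow> 'd tensor_series" where
  "tproj k A = (\<lambda>w. if length w = k then A w else 0)"

definition tvec :: "real ^ 'd \<Rightarrow> 'd tensor_series" where
  "tvec v = (\<lambda>w. if length w = 1 then v $ hd w else 0)"

text \<open>Meant for series with constant term 1. Then the \<open>k\<close>-th power of \<open>A - 1\<close> vanishes on
  words shorter than \<open>k\<close>, so the sum is finite at every word.\<close>

definition tlog :: "'d tensor_series \<Rightarrow> 'd tensor_series" where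
  "tlog A = (\<lambda>w. \<Sum>n. (-1) ^ n / real (Suc n) * tpow (tminus A tone) (Suc n) w)"


section \<open>Lie series\<close>

definition bracket :: "'d tensor_series \<Rightarrow> 'd tensor_series \<Rightarrow> 'd tensor_series" where
  "bracket A B = tminus (tprod A B) (tprod B A)"

text \<open>\<open>[v\<^sub>1, [v\<^sub>2, \<dots> [v\<^bsub>k-1\<^esub>, v\<^sub>k] \<dots>]]\<close>; the value at the empty list is irrelevant.\<close>

fun iter_bracket :: "(real ^ 'd) list \<Rightarrow> 'd tensor_series" where
  "iter_bracket [] = tzero"
| "iter_bracket [v] = tvec v"
| "iter_bracket (v # u # vs) = bracket (tvec v) (iter_bracket (u # vs))"

definition lie_homogeneous :: "nat \<Rightarrow> 'd::finite tensor_series \<Rightarrow> bool" where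
  "lie_homogeneous k A \<longleftrightarrow>
     (\<exists>(N::nat) (c :: nat \<Rightarrow> real) (V :: nat \<Rightarrow> (real ^ 'd) list).
        (\<forall>j<N. length (V j) = k) \<and>
        A = (\<lambda>w. \<Sum>j<N. c j * iter_bracket (V j) w))"

definition lie_series :: "'d::finite tensor_series \<Rightarrow> bool" where
  "lie_series A \<longleftrightarrow> tproj 0 A = tzero \<and> (\<forall>k\<ge>1. lie_homogeneous k (tproj k A))"

definition lie_polynomial :: "'d::finite tensor_series \<Rightarrow> bool" where
  "lie_polynomial A \<longleftrightarrow> lie_series A \<and> finite {k. tproj k A \<noteq> tzero}"


section \<open>Rectifiable paths and signatures\<close>

text \<open>A path on \<open>[a, b]\<close> is a total function of which only the values on \<open>{a..b}\<close> are used.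
  Below, \<open>K\<close> ranges over compact intervals, so \<open>Inf K\<close> and \<open>Sup K\<close> are its end points.\<close>

definition bounded_variation_on :: "(real \<Rightarrow> 'a::real_normed_vector) \<Rightarrow> real \<Rightarrow> real \<Rightarrow> bool" where
  "bounded_variation_on \<gamma> a b \<longleftrightarrow>
     (\<exists>B. \<forall>D. D division_of {a..b} \<longrightarrow> (\<Sum>K\<in>D. norm (\<gamma> (Sup K) - \<gamma> (Inf K))) \<le> B)"

definition rectifiable :: "(real \<Rightarrow> 'a::real_normed_vector) \<Rightarrow> real \<Rightarrow> real \<Rightarrow> bool" where
  "rectifiable \<gamma> a b \<longleftrightarrow> continuous_on {a..b} \<gamma> \<and> bounded_variation_on \<gamma> a b"

text \<open>Riemann--Stieltjes integral. The constant gauge \<open>\<lambda>x. ball x \<delta>\<close> expresses convergence as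
  the mesh tends to 0.\<close>

definition has_rs_integral ::
    "(real \<Rightarrow> real) \<Rightarrow> (real \<Rightarrow> real) \<Rightarrow> real \<Rightarrow> real \<Rightarrow> real \<Rightarrow> bool" where
  "has_rs_integral f g a b I \<longleftrightarrow>
     (\<forall>\<epsilon>>0. \<exists>\<delta>>0. \<forall>p. p tagged_division_of {a..b} \<and> (\<lambda>x. ball x \<delta>) fine p \<longrightarrow>
        \<bar>(\<Sum>(x, K)\<in>p. f x * (g (Sup K) - g (Inf K))) - I\<bar> < \<epsilon>)"

definition rs_integral :: "(real \<Rightarrow> real) \<Rightarrow> (real \<Rightarrow> real) \<Rightarrow> real \<Rightarrow> real \<Rightarrow> real" where
  "rs_integral f g a b = (THE I. has_rs_integral f g a b I)"

text \<open>The list holds the indices in reverse order, the outermost integration variable first: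
  \<open>iter_integral \<gamma> a [i\<^sub>k, \<dots>, i\<^sub>1] t\<close> is the integral of
  \<open>d\<gamma>\<^bsub>i\<^sub>1\<^esub>(s\<^sub>1) \<dots> d\<gamma>\<^bsub>i\<^sub>k\<^esub>(s\<^sub>k)\<close> over \<open>a < s\<^sub>1 < \<dots> < s\<^sub>k < t\<close>. The recursion is
  \<open>dS = S \<otimes> d\<gamma>\<close>, \<open>S(a) = 1\<close> read off coefficientwise.\<close>

primrec iter_integral :: "(real \<Rightarrow> real ^ 'd) \<Rightarrow> real \<Rightarrow> 'd list \<Rightarrow> real \<Rightarrow> real" where
  "iter_integral \<gamma> a [] = (\<lambda>t. 1)"
| "iter_integral \<gamma> a (i # w) = (\<lambda>t. rs_integral (iter_integral \<gamma> a w) (\<lambda>s. \<gamma> s $ i) a t)"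

text \<open>Signature of the restriction of \<open>\<gamma>\<close> to \<open>[a, b]\<close>.\<close>

definition signature :: "(real \<Rightarrow> real ^ 'd) \<Rightarrow> real \<Rightarrow> real \<Rightarrow> 'd tensor_series" where
  "signature \<gamma> a b = (\<lambda>w. iter_integral \<gamma> a (rev w) b)"

definition log_signature :: "(real \<Rightarrow> real ^ 'd) \<Rightarrow> real \<Rightarrow> real \<Rightarrow> 'd tensor_series" where
  "log_signature \<gamma> a b = tlog (signature \<gamma> a b)"

definition reduced_path :: "(real \<Rightarrow> real ^ 'd) \<Rightarrow> real \<Rightarrow> real \<Rightarrow> bool" where
  "reduced_path \<gamma> a b \<longleftrightarrow>
     \<not> (\<exists>s0 s1. a \<le> s0 \<and> s0 < s1 \<and> s1 \<le> b \<and> signature \<gamma> s0 s1 = tone)"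

end

theory Submission
  imports Defs
begin

text \<open>Write \<open>X t\<close> for the signature of \<open>\<gamma>\<close> restricted to \<open>[t0, t]\<close>. The map \<open>X\<close> is injective: by Chen's
identity (\<open>chen_identity\<close>), \<open>X s = X t\<close> with \<open>s < t\<close> would make the signature of \<open>\<gamma>\<close> on \<open>[s, t]\<close> trivial.

Suppose that the log-signature \<open>P\<close> is a Lie polynomial whose terms have degree less than \<open>N\<close>, so that
\<open>X t1 = exp P\<close>. The idea is that \<open>X\<close> then satisfies every polynomial equation that holds along the
curve \<open>s \<mapsto> exp (s P)\<close>.

\<^item> Finite linear combinations of words are functions on tensor series, and on signatures the product of
  functions is the shuffle product (\<open>shuffle_identity\<close>). Along \<open>X\<close> such a function \<open>q\<close> changes by
  \<open>dq(X) = \<Sum>\<^sub>i (D\<^sub>i q)(X) d\<gamma>\<^sub>i\<close>, where \<open>D\<^sub>i\<close> takes the letter \<open>i\<close> off a word. Hence the integral of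
  \<open>q(X) d\<gamma>\<^sub>i\<close> over the whole path is the value at \<open>exp P\<close> of the function \<open>q i\<close> in which \<open>i\<close> is appended to
  all words.
\<^item> Along \<open>exp (s P)\<close> a function \<open>q\<close> has the derivative \<open>D\<^sub>P q = \<Sum>\<^sub>w P\<^sub>w D\<^sub>w q\<close>. This \<open>D\<^sub>P\<close> is a derivation
  because \<open>P\<close> is a Lie element, and each \<open>D\<^sub>w\<close> that occurs consists of fewer than \<open>N\<close> letter derivatives
  because \<open>P\<close> is a polynomial.
\<^item> Let \<open>p\<close> vanish along \<open>exp (s P)\<close>, and let \<open>q\<close> be any function. One letter derivative turns
  \<open>(p\<^sup>N q) i\<close> into \<open>p\<^sup>N q\<close>, and after fewer than \<open>N\<close> more a factor \<open>p\<close> is left. So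
  \<open>D\<^sub>P ((p\<^sup>N q) i)\<close> vanishes along the curve, and then so does \<open>(p\<^sup>N q) i\<close>, which is 0 at \<open>s = 0\<close>.
  At the end point this says that the integral of \<open>p(X)\<^sup>N q(X) d\<gamma>\<^sub>i\<close> is 0 (\<open>append_letter_in_curve_ideal\<close>).
\<^item> Since \<open>X\<close> is injective, the functions \<open>q(X)\<close> are uniformly dense among the continuous functions on
  \<open>[t0, t1]\<close> by the Stone--Weierstrass theorem. Hence the measures \<open>p(X)\<^sup>N d\<gamma>\<^sub>i\<close> are zero. A reduced path
  is not constant on any interval, so \<open>p(X) = 0\<close> (\<open>vanishing_on_path\<close>).

For \<open>p\<close> one takes the equations that express all coordinates of \<open>exp (s P)\<close> by one of them, namely a word
\<open>z\<close> of minimal length with \<open>P\<^sub>z \<noteq> 0\<close>, whose value is \<open>s P\<^sub>z\<close>. They give \<open>X t = exp (s(t) P)\<close> with a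
continuous injective \<open>s\<close> from 0 to 1. On words of length 1 this reads \<open>\<gamma> t - \<gamma> t0 = s(t) P\<^sub>1\<close> for the
vector \<open>P\<^sub>1\<close> of the coefficients of \<open>P\<close> on letters, so \<open>\<gamma>\<close> is straight (\<open>straight_if_polynomial\<close>).

Conversely the signature of a straight path in direction \<open>v\<close> is \<open>exp v\<close>, with logarithm \<open>v\<close>
(\<open>polynomial_if_straight\<close>).\<close>

section \<open>Stieltjes differentials relative to a control\<close>

text \<open>Riemann--Stieltjes integrals are handled by their differentials. A control \<open>W\<close> dominates the
increments of all functions involved, and \<open>dF = f dg\<close> means that \<open>F t - F s\<close> and \<open>f x (g t - g s)\<close>, for
\<open>s \<le> x \<le> t\<close>, differ by a small multiple of \<open>W t - W s\<close> once \<open>t - s\<close> is small. The integration rules then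
become pointwise estimates, and the integral is recovered by summing over a fine division. The control
also dominates the increments of \<open>t\<close>, so that \<open>dt\<close> is among the admissible differentials.\<close>

locale control =
  fixes W :: "real \<Rightarrow> real"
  assumes increment: "s \<le> t \<Longrightarrow> t - s \<le> W t - W s"
begin

lemma increment_nonneg: "s \<le> t \<Longrightarrow> 0 \<le> W t - W s"
  using increment[of s t] by simp

definition negligible :: "real \<Rightarrow> real \<Rightarrow> (real \<Rightarrow> real \<Rightarrow> real \<Rightarrow> real) \<Rightarrow> bool" where
  "negligible a b A \<longleftrightarrow>
     (\<forall>\<epsilon>>0. \<exists>\<delta>>0. \<forall>s x t. a \<le> s \<longrightarrow> s \<le> x \<longrightarrow> x \<le> t \<longrightarrow> t \<le> b \<longrightarrow> t - s < \<delta> \<longrightarrow>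
        \<bar>A s x t\<bar> \<le> \<epsilon> * (W t - W s))"

lemma negligibleE:
  assumes "negligible a b A" "0 < \<epsilon>"
  obtains \<delta> where "0 < \<delta>"
    "\<And>s x t. \<lbrakk>a \<le> s; s \<le> x; x \<le> t; t \<le> b; t - s < \<delta>\<rbrakk> \<Longrightarrow> \<bar>A s x t\<bar> \<le> \<epsilon> * (W t - W s)"
  using assms unfolding negligible_def by metis

lemma negligible_mono:
  assumes "negligible a b A" "a \<le> a'" "b' \<le> b"
    and "\<And>s x t. \<lbrakk>a' \<le> s; s \<le> x; x \<le> t; t \<le> b'\<rbrakk> \<Longrightarrow> \<bar>B s x t\<bar> \<le> \<bar>A s x t\<bar>"
  shows "negligible a' b' B"
  unfolding negligible_def
proof (intro allI impI)
  fix \<epsilon> :: real assume "0 < \<epsilon>"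
  then obtain \<delta> where "0 < \<delta>" and \<delta>:
    "\<And>s x t. \<lbrakk>a \<le> s; s \<le> x; x \<le> t; t \<le> b; t - s < \<delta>\<rbrakk> \<Longrightarrow> \<bar>A s x t\<bar> \<le> \<epsilon> * (W t - W s)"
    using negligibleE[OF assms(1)] by metis
  have "\<bar>B s x t\<bar> \<le> \<epsilon> * (W t - W s)" if "a' \<le> s" "s \<le> x" "x \<le> t" "t \<le> b'" "t - s < \<delta>" for s x t
    using assms(4)[OF that(1-4)] \<delta>[of s x t] that assms(2,3) by fastforce
  with \<open>0 < \<delta>\<close> show "\<exists>\<delta>>0. \<forall>s x t. a' \<le> s \<longrightarrow> s \<le> x \<longrightarrow> x \<le> t \<longrightarrow> t \<le> b' \<longrightarrow> t - s < \<delta> \<longrightarrow>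
      \<bar>B s x t\<bar> \<le> \<epsilon> * (W t - W s)" by blast
qed

lemma negligible_cong:
  assumes "negligible a b A"
    and "\<And>s x t. \<lbrakk>a \<le> s; s \<le> x; x \<le> t; t \<le> b\<rbrakk> \<Longrightarrow> B s x t = A s x t"
  shows "negligible a b B"
  using negligible_mono[OF assms(1), of a b B] assms(2) by simp

lemma negligible_zero: "negligible a b (\<lambda>s x t. 0)"
  unfolding negligible_def using increment_nonneg
  by (smt (verit, best) mult_nonneg_nonneg)

lemma negligible_add:
  assumes "negligible a b A" "negligible a b B"
  shows "negligible a b (\<lambda>s x t. A s x t + B s x t)"
  unfolding negligible_def
proof (intro allI impI)
  fix \<epsilon> :: real assume "0 < \<epsilon>"
  then have e: "0 < \<epsilon> / 2" by simp
  obtain d1 where "0 < d1" and d1: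
    "\<And>s x t. \<lbrakk>a \<le> s; s \<le> x; x \<le> t; t \<le> b; t - s < d1\<rbrakk> \<Longrightarrow> \<bar>A s x t\<bar> \<le> \<epsilon> / 2 * (W t - W s)"
    using negligibleE[OF assms(1) e] by metis
  obtain d2 where "0 < d2" and d2:
    "\<And>s x t. \<lbrakk>a \<le> s; s \<le> x; x \<le> t; t \<le> b; t - s < d2\<rbrakk> \<Longrightarrow> \<bar>B s x t\<bar> \<le> \<epsilon> / 2 * (W t - W s)"
    using negligibleE[OF assms(2) e] by metis
  have "\<bar>A s x t + B s x t\<bar> \<le> \<epsilon> * (W t - W s)"
    if "a \<le> s" "s \<le> x" "x \<le> t" "t \<le> b" "t - s < min d1 d2" for s x t
    using d1[of s x t] d2[of s x t] that by (simp add: field_simps)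
  with \<open>0 < d1\<close> \<open>0 < d2\<close> show "\<exists>\<delta>>0. \<forall>s x t. a \<le> s \<longrightarrow> s \<le> x \<longrightarrow> x \<le> t \<longrightarrow> t \<le> b \<longrightarrow> t - s < \<delta> \<longrightarrow>
      \<bar>A s x t + B s x t\<bar> \<le> \<epsilon> * (W t - W s)" by (intro exI[of _ "min d1 d2"]) auto
qed

lemma negligible_mult:
  assumes "negligible a b A"
    and "\<And>s x t. \<lbrakk>a \<le> s; s \<le> x; x \<le> t; t \<le> b\<rbrakk> \<Longrightarrow> \<bar>c s x t\<bar> \<le> K"
  shows "negligible a b (\<lambda>s x t. c s x t * A s x t)"
  unfolding negligible_def
proof (intro allI impI)
  fix \<epsilon> :: real assume "0 < \<epsilon>"
  then have e: "0 < \<epsilon> / (\<bar>K\<bar> + 1)" by simp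
  obtain d where "0 < d" and d:
    "\<And>s x t. \<lbrakk>a \<le> s; s \<le> x; x \<le> t; t \<le> b; t - s < d\<rbrakk> \<Longrightarrow> \<bar>A s x t\<bar> \<le> \<epsilon> / (\<bar>K\<bar> + 1) * (W t - W s)"
    using negligibleE[OF assms(1) e] by metis
  have "\<bar>c s x t * A s x t\<bar> \<le> \<epsilon> * (W t - W s)"
    if "a \<le> s" "s \<le> x" "x \<le> t" "t \<le> b" "t - s < d" for s x t
  proof -
    have "\<bar>c s x t * A s x t\<bar> \<le> (\<bar>K\<bar> + 1) * (\<epsilon> / (\<bar>K\<bar> + 1) * (W t - W s))"
      unfolding abs_mult using assms(2)[of s x t] d[of s x t] that by (intro mult_mono) auto
    then show ?thesis by simp
  qed
  with \<open>0 < d\<close> show "\<exists>\<delta>>0. \<forall>s x t. a \<le> s \<longrightarrow> s \<le> x \<longrightarrow> x \<le> t \<longrightarrow> t \<le> b \<longrightarrow> t - s < \<delta> \<longrightarrow>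
      \<bar>c s x t * A s x t\<bar> \<le> \<epsilon> * (W t - W s)" by blast
qed

lemma negligible_cmult: "negligible a b A \<Longrightarrow> negligible a b (\<lambda>s x t. c * A s x t)"
  by (rule negligible_mult[where K = "\<bar>c\<bar>"]) auto

lemma negligible_diff:
  assumes "negligible a b A" "negligible a b B"
  shows "negligible a b (\<lambda>s x t. A s x t - B s x t)"
  using negligible_add[OF assms(1) negligible_cmult[OF assms(2), of "-1"]] by simp

lemma negligible_sum:
  assumes "\<And>i. i \<in> I \<Longrightarrow> negligible a b (A i)"
  shows "negligible a b (\<lambda>s x t. \<Sum>i\<in>I. A i s x t)"
  using assms
proof (induction I rule: infinite_finite_induct)
  case (insert i I)
  then show ?case using negligible_add[of a b "A i" "\<lambda>s x t. \<Sum>i\<in>I. A i s x t"] by simp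
qed (auto simp: negligible_zero)

text \<open>The increments of \<open>W\<close> over a division add up to \<open>W b - W a\<close>, whatever the number of pieces.\<close>

lemma negligible_riemann_sum:
  assumes "negligible a b A" "a \<le> b" "0 < \<epsilon>"
  shows "\<exists>\<delta>>0. \<forall>p. p tagged_division_of {a..b} \<and> (\<lambda>x. ball x \<delta>) fine p \<longrightarrow>
       (\<Sum>(x, K)\<in>p. \<bar>A (Inf K) x (Sup K)\<bar>) \<le> \<epsilon> * (W b - W a)"
proof -
  obtain d where "0 < d" and d:
    "\<And>s x t. \<lbrakk>a \<le> s; s \<le> x; x \<le> t; t \<le> b; t - s < d\<rbrakk> \<Longrightarrow> \<bar>A s x t\<bar> \<le> \<epsilon> * (W t - W s)"
    using negligibleE[OF assms(1,3)] by metis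
  show ?thesis
  proof (intro exI[of _ "d / 2"] conjI allI impI; (elim conjE)?)
    show "0 < d / 2" using \<open>0 < d\<close> by simp
    fix p assume p: "p tagged_division_of {a..b}" and fine: "(\<lambda>x. ball x (d / 2)) fine p"
    have "(\<Sum>(x, K)\<in>p. \<bar>A (Inf K) x (Sup K)\<bar>) \<le> (\<Sum>(x, K)\<in>p. \<epsilon> * (W (Sup K) - W (Inf K)))"
    proof (rule sum_mono, clarify)
      fix x K assume xK: "(x, K) \<in> p"
      obtain u v where K: "K = {u..v}" using tagged_division_ofD(4)[OF p xK] by auto
      have "x \<in> K" "K \<subseteq> {a..b}" using tagged_division_ofD(2,3)[OF p xK] by auto
      then have "a \<le> u" "u \<le> x" "x \<le> v" "v \<le> b" by (auto simp: K)
      moreover have "K \<subseteq> ball x (d / 2)" using fine xK by (auto simp: fine_def)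
      then have "u \<in> ball x (d / 2)" "v \<in> ball x (d / 2)"
        using \<open>u \<le> x\<close> \<open>x \<le> v\<close> unfolding K by (metis atLeastAtMost_iff order.refl order_trans subsetD)+
      then have "v - u < d" by (auto simp: dist_real_def abs_real_def split: if_splits)
      ultimately show "\<bar>A (Inf K) x (Sup K)\<bar> \<le> \<epsilon> * (W (Sup K) - W (Inf K))"
        using d[of u x v] by (simp add: K)
    qed
    also have "\<dots> = \<epsilon> * (\<Sum>(x, K)\<in>p. W (Sup K) - W (Inf K))"
      by (simp add: sum_distrib_left split_def)
    also have "\<dots> = \<epsilon> * (W b - W a)" using additive_tagged_division_1[OF assms(2) p, of W] by simp
    finally show "(\<Sum>(x, K)\<in>p. \<bar>A (Inf K) x (Sup K)\<bar>) \<le> \<epsilon> * (W b - W a)" .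
  qed
qed

text \<open>The increment of \<open>F\<close> is the sum of its increments over the pieces of a fine division, and on each piece
it is \<open>B\<close> up to a negligible error.\<close>

lemma increment_bound:
  assumes A: "negligible a b (\<lambda>s x t. F t - F s - B s x t)" and "a \<le> b"
    and B: "\<And>s x t. \<lbrakk>a \<le> s; s \<le> x; x \<le> t; t \<le> b\<rbrakk> \<Longrightarrow> \<bar>B s x t\<bar> \<le> C * (W t - W s)"
  shows "\<bar>F b - F a\<bar> \<le> C * (W b - W a)"
proof (rule field_le_epsilon)
  fix e :: real assume "0 < e"
  \<comment> \<open>the summand \<open>1\<close> only keeps the denominator positive\<close>
  define \<epsilon> where "\<epsilon> = e / (W b - W a + 1)"
  have pos: "0 < W b - W a + 1" using increment_nonneg[OF \<open>a \<le> b\<close>] by simp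
  have "0 < \<epsilon>" using pos \<open>0 < e\<close> by (simp add: \<epsilon>_def)
  from negligible_riemann_sum[OF A \<open>a \<le> b\<close> \<open>0 < \<epsilon>\<close>] obtain \<delta> where "0 < \<delta>" and \<delta>:
    "\<forall>p. p tagged_division_of {a..b} \<and> (\<lambda>x. ball x \<delta>) fine p \<longrightarrow>
       (\<Sum>(x, K)\<in>p. \<bar>F (Sup K) - F (Inf K) - B (Inf K) x (Sup K)\<bar>) \<le> \<epsilon> * (W b - W a)"
    by blast
  obtain p where p: "p tagged_division_of {a..b}" "(\<lambda>x. ball x \<delta>) fine p"
    using fine_division_exists_real[OF gauge_ball[OF \<open>0 < \<delta>\<close>]] by metis
  have "\<bar>F b - F a\<bar> = \<bar>\<Sum>(x, K)\<in>p. F (Sup K) - F (Inf K)\<bar>"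
    using additive_tagged_division_1[OF \<open>a \<le> b\<close> p(1), of F] by simp
  also have "\<dots> \<le> (\<Sum>(x, K)\<in>p. \<bar>F (Sup K) - F (Inf K)\<bar>)"
    by (rule order_trans[OF sum_abs]) (simp add: split_def)
  also have "\<dots> \<le> (\<Sum>(x, K)\<in>p. \<bar>F (Sup K) - F (Inf K) - B (Inf K) x (Sup K)\<bar> + C * (W (Sup K) - W (Inf K)))"
  proof (rule sum_mono, clarify)
    fix x K assume xK: "(x, K) \<in> p"
    obtain u v where K: "K = {u..v}" using tagged_division_ofD(4)[OF p(1) xK] by auto
    have "x \<in> K" "K \<subseteq> {a..b}" using tagged_division_ofD(2,3)[OF p(1) xK] by auto
    then show "\<bar>F (Sup K) - F (Inf K)\<bar>
        \<le> \<bar>F (Sup K) - F (Inf K) - B (Inf K) x (Sup K)\<bar> + C * (W (Sup K) - W (Inf K))"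
      using B[of u x v] by (auto simp: K)
  qed
  also have "\<dots> = (\<Sum>(x, K)\<in>p. \<bar>F (Sup K) - F (Inf K) - B (Inf K) x (Sup K)\<bar>)
      + C * (\<Sum>(x, K)\<in>p. W (Sup K) - W (Inf K))"
    by (simp add: sum.distrib sum_distrib_left split_def)
  also have "\<dots> \<le> \<epsilon> * (W b - W a) + C * (W b - W a)"
    using \<delta> p additive_tagged_division_1[OF \<open>a \<le> b\<close> p(1), of W] by simp
  also have "\<epsilon> * (W b - W a) \<le> e"
    using pos \<open>0 < e\<close> by (simp add: \<epsilon>_def field_simps)
  finally show "\<bar>F b - F a\<bar> \<le> C * (W b - W a) + e" by simp
qed

lemma constant_if_negligible:
  assumes "negligible a b (\<lambda>s x t. F t - F s)" "a \<le> t" "t \<le> b"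
  shows "F t = F a"
proof -
  have "negligible a t (\<lambda>s x t. F t - F s - 0)"
    using negligible_mono[OF assms(1)] assms by simp
  from increment_bound[OF this assms(2), of 0] show ?thesis by simp
qed

definition controlled :: "real \<Rightarrow> real \<Rightarrow> (real \<Rightarrow> real) \<Rightarrow> bool" where
  "controlled a b F \<longleftrightarrow> continuous_on {a..b} F \<and>
     (\<exists>C\<ge>0. \<forall>s t. a \<le> s \<longrightarrow> s \<le> t \<longrightarrow> t \<le> b \<longrightarrow> \<bar>F t - F s\<bar> \<le> C * (W t - W s))"

lemma controlledE:
  assumes "controlled a b F"
  obtains C where "0 \<le> C" "\<And>s t. \<lbrakk>a \<le> s; s \<le> t; t \<le> b\<rbrakk> \<Longrightarrow> \<bar>F t - F s\<bar> \<le> C * (W t - W s)"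
  using assms unfolding controlled_def by metis

lemma controlled_continuous: "controlled a b F \<Longrightarrow> continuous_on {a..b} F"
  by (simp add: controlled_def)

lemma controlled_const: "controlled a b (\<lambda>t. c)"
  by (auto simp: controlled_def)

lemma controlled_ident: "controlled a b (\<lambda>x. x)"
  unfolding controlled_def using increment by (auto intro!: exI[of _ 1] continuous_intros)

lemma controlled_cmult:
  assumes "controlled a b F"
  shows "controlled a b (\<lambda>t. c * F t)"
proof -
  obtain C where C: "0 \<le> C" "\<And>s t. \<lbrakk>a \<le> s; s \<le> t; t \<le> b\<rbrakk> \<Longrightarrow> \<bar>F t - F s\<bar> \<le> C * (W t - W s)"
    using controlledE[OF assms] by metis
  have "\<bar>c * F t - c * F s\<bar> \<le> \<bar>c\<bar> * C * (W t - W s)" if "a \<le> s" "s \<le> t" "t \<le> b" for s t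
    using mult_left_mono[OF C(2)[OF that], of "\<bar>c\<bar>"] by (simp add: abs_mult[symmetric] algebra_simps)
  then show ?thesis
    using controlled_continuous[OF assms] C(1) unfolding controlled_def
    by (auto intro!: continuous_intros exI[of _ "\<bar>c\<bar> * C"])
qed

lemma controlled_add:
  assumes "controlled a b F" "controlled a b G"
  shows "controlled a b (\<lambda>t. F t + G t)"
proof -
  obtain C where C: "0 \<le> C" "\<And>s t. \<lbrakk>a \<le> s; s \<le> t; t \<le> b\<rbrakk> \<Longrightarrow> \<bar>F t - F s\<bar> \<le> C * (W t - W s)"
    using controlledE[OF assms(1)] by metis
  obtain D where D: "0 \<le> D" "\<And>s t. \<lbrakk>a \<le> s; s \<le> t; t \<le> b\<rbrakk> \<Longrightarrow> \<bar>G t - G s\<bar> \<le> D * (W t - W s)"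
    using controlledE[OF assms(2)] by metis
  have "\<bar>F t + G t - (F s + G s)\<bar> \<le> (C + D) * (W t - W s)" if "a \<le> s" "s \<le> t" "t \<le> b" for s t
    using C(2)[OF that] D(2)[OF that] by (simp add: distrib_right)
  then show ?thesis
    using assms[THEN controlled_continuous] C(1) D(1) unfolding controlled_def
    by (auto intro!: continuous_intros exI[of _ "C + D"])
qed

lemma controlled_sum: "(\<And>i. i \<in> I \<Longrightarrow> controlled a b (F i)) \<Longrightarrow> controlled a b (\<lambda>t. \<Sum>i\<in>I. F i t)"
  by (induction I rule: infinite_finite_induct) (simp_all add: controlled_const controlled_add)

lemma controlled_cong:
  assumes "controlled a b F" "\<And>t. t \<in> {a..b} \<Longrightarrow> G t = F t"
  shows "controlled a b G"
  using assms continuous_on_cong[of "{a..b}" "{a..b}" G F] by (auto simp: controlled_def)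

lemma controlled_mono:
  assumes "controlled a b F" "a \<le> c" "d \<le> b"
  shows "controlled c d F"
proof -
  obtain C where C: "0 \<le> C" "\<And>s t. \<lbrakk>a \<le> s; s \<le> t; t \<le> b\<rbrakk> \<Longrightarrow> \<bar>F t - F s\<bar> \<le> C * (W t - W s)"
    using controlledE[OF assms(1)] by metis
  have "continuous_on {c..d} F"
    by (rule continuous_on_subset[OF controlled_continuous[OF assms(1)]]) (use assms in auto)
  with C assms show ?thesis unfolding controlled_def by (intro conjI exI[of _ C]) auto
qed

end

lemma continuous_bounded:
  assumes "continuous_on {a..b::real} (f :: real \<Rightarrow> real)"
  obtains K where "0 \<le> K" "\<And>x. x \<in> {a..b} \<Longrightarrow> \<bar>f x\<bar> \<le> K"
proof -
  have "bounded (f ` {a..b})" by (intro compact_imp_bounded compact_continuous_image assms) simp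
  then obtain K where "\<forall>y\<in>f ` {a..b}. norm y \<le> K" unfolding bounded_iff by blast
  then have K: "\<And>x. x \<in> {a..b} \<Longrightarrow> \<bar>f x\<bar> \<le> K" by simp
  show thesis by (rule that[of "\<bar>K\<bar>"]) (use K in \<open>force+\<close>)
qed

context control
begin

text \<open>Uniform continuity of \<open>f\<close>: it does not matter at which point of \<open>[s, t]\<close> the function \<open>f\<close> is evaluated.\<close>

lemma negligible_oscillation:
  assumes f: "continuous_on {a..b} f" and g: "controlled a b g"
    and pq: "\<And>s x t. \<lbrakk>s \<le> x; x \<le> t\<rbrakk> \<Longrightarrow> p s x t \<in> {s..t} \<and> q s x t \<in> {s..t}"
  shows "negligible a b (\<lambda>s x t. (f (p s x t) - f (q s x t)) * (g t - g s))"
  unfolding negligible_def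
proof (intro allI impI)
  fix \<epsilon> :: real assume "0 < \<epsilon>"
  obtain C where "0 \<le> C" and C: "\<And>s t. \<lbrakk>a \<le> s; s \<le> t; t \<le> b\<rbrakk> \<Longrightarrow> \<bar>g t - g s\<bar> \<le> C * (W t - W s)"
    using controlledE[OF g] by metis
  have "uniformly_continuous_on {a..b} f" by (intro compact_uniformly_continuous f) simp
  moreover have e: "0 < \<epsilon> / (C + 1)" using \<open>0 \<le> C\<close> \<open>0 < \<epsilon>\<close> by simp
  ultimately obtain d where "0 < d" and d:
    "\<And>x x'. \<lbrakk>x \<in> {a..b}; x' \<in> {a..b}; dist x' x < d\<rbrakk> \<Longrightarrow> dist (f x') (f x) < \<epsilon> / (C + 1)"
    unfolding uniformly_continuous_on_def by metis
  have "\<bar>(f (p s x t) - f (q s x t)) * (g t - g s)\<bar> \<le> \<epsilon> * (W t - W s)"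
    if *: "a \<le> s" "s \<le> x" "x \<le> t" "t \<le> b" "t - s < d" for s x t
  proof -
    have "\<bar>f (p s x t) - f (q s x t)\<bar> \<le> \<epsilon> / (C + 1)"
      using d[of "q s x t" "p s x t"] pq[of s x t] * by (auto simp: dist_real_def abs_less_iff)
    moreover have "\<bar>g t - g s\<bar> \<le> (C + 1) * (W t - W s)"
      using C[of s t] * increment_nonneg[of s t] by (simp add: algebra_simps)
    ultimately have "\<bar>(f (p s x t) - f (q s x t)) * (g t - g s)\<bar> \<le> \<epsilon> / (C + 1) * ((C + 1) * (W t - W s))"
      unfolding abs_mult using e by (intro mult_mono) auto
    then show ?thesis using \<open>0 \<le> C\<close> by simp
  qed
  with \<open>0 < d\<close> show "\<exists>\<delta>>0. \<forall>s x t. a \<le> s \<longrightarrow> s \<le> x \<longrightarrow> x \<le> t \<longrightarrow> t \<le> b \<longrightarrow> t - s < \<delta> \<longrightarrow>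
      \<bar>(f (p s x t) - f (q s x t)) * (g t - g s)\<bar> \<le> \<epsilon> * (W t - W s)" by blast
qed

text \<open>This is the relation \<open>dF = f dg\<close>.\<close>

definition stieltjes :: "real \<Rightarrow> real \<Rightarrow> (real \<Rightarrow> real) \<Rightarrow> (real \<Rightarrow> real) \<Rightarrow> (real \<Rightarrow> real) \<Rightarrow> bool" where
  "stieltjes a b F f g \<longleftrightarrow> negligible a b (\<lambda>s x t. F t - F s - f x * (g t - g s))"

lemma stieltjes_subinterval:
  "\<lbrakk>stieltjes a b F f g; a \<le> a'; b' \<le> b\<rbrakk> \<Longrightarrow> stieltjes a' b' F f g"
  unfolding stieltjes_def by (erule negligible_mono) auto

lemma stieltjes_cong:
  assumes "stieltjes a b F f g" "\<And>t. t \<in> {a..b} \<Longrightarrow> F' t = F t" "\<And>t. t \<in> {a..b} \<Longrightarrow> f' t = f t"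
  shows "stieltjes a b F' f' g"
  using assms(1) unfolding stieltjes_def by (rule negligible_cong) (simp add: assms)

lemma stieltjes_diff:
  assumes "stieltjes a b F f g" "stieltjes a b F' f' g"
  shows "stieltjes a b (\<lambda>x. F x - F' x) (\<lambda>x. f x - f' x) g"
  using negligible_diff[OF assms[unfolded stieltjes_def]] unfolding stieltjes_def
  by (rule negligible_cong) (simp add: algebra_simps)

lemma stieltjes_has_rs_integral:
  assumes "stieltjes a b F f g" "a \<le> t" "t \<le> b"
  shows "has_rs_integral f g a t (F t - F a)"
  unfolding has_rs_integral_def
proof (intro allI impI)
  fix e :: real assume "0 < e"
  define \<epsilon> where "\<epsilon> = e / (W t - W a + 1)"
  have pos: "0 < W t - W a + 1" using increment_nonneg[OF \<open>a \<le> t\<close>] by simp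
  have "0 < \<epsilon>" using pos \<open>0 < e\<close> by (simp add: \<epsilon>_def)
  have "negligible a t (\<lambda>s x t. F t - F s - f x * (g t - g s))"
    using stieltjes_subinterval[OF assms(1)] assms(3) by (simp add: stieltjes_def)
  from negligible_riemann_sum[OF this \<open>a \<le> t\<close> \<open>0 < \<epsilon>\<close>] obtain \<delta> where "0 < \<delta>" and \<delta>:
    "\<forall>p. p tagged_division_of {a..t} \<and> (\<lambda>x. ball x \<delta>) fine p \<longrightarrow>
       (\<Sum>(x, K)\<in>p. \<bar>F (Sup K) - F (Inf K) - f x * (g (Sup K) - g (Inf K))\<bar>) \<le> \<epsilon> * (W t - W a)"
    by blast
  have "\<bar>(\<Sum>(x, K)\<in>p. f x * (g (Sup K) - g (Inf K))) - (F t - F a)\<bar> < e"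
    if p: "p tagged_division_of {a..t}" "(\<lambda>x. ball x \<delta>) fine p" for p
  proof -
    have "\<bar>(\<Sum>(x, K)\<in>p. f x * (g (Sup K) - g (Inf K))) - (F t - F a)\<bar>
      = \<bar>\<Sum>(x, K)\<in>p. F (Sup K) - F (Inf K) - f x * (g (Sup K) - g (Inf K))\<bar>"
      using additive_tagged_division_1[OF \<open>a \<le> t\<close> p(1), of F]
      by (simp add: split_def sum_subtractf abs_minus_commute)
    also have "\<dots> \<le> (\<Sum>(x, K)\<in>p. \<bar>F (Sup K) - F (Inf K) - f x * (g (Sup K) - g (Inf K))\<bar>)"
      by (rule order_trans[OF sum_abs]) (simp add: split_def)
    also have "\<dots> \<le> \<epsilon> * (W t - W a)" using \<delta> p by blast
    also have "\<dots> < \<epsilon> * (W t - W a + 1)" using \<open>0 < \<epsilon>\<close> by simp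
    also have "\<dots> = e" using pos by (simp add: \<epsilon>_def)
    finally show ?thesis .
  qed
  with \<open>0 < \<delta>\<close> show "\<exists>\<delta>>0. \<forall>p. p tagged_division_of {a..t} \<and> (\<lambda>x. ball x \<delta>) fine p \<longrightarrow>
      \<bar>(\<Sum>(x, K)\<in>p. f x * (g (Sup K) - g (Inf K))) - (F t - F a)\<bar> < e" by blast
qed

end

lemma has_rs_integral_unique:
  assumes "has_rs_integral f g a b I" "has_rs_integral f g a b J"
  shows "I = J"
proof (rule ccontr)
  assume "I \<noteq> J"
  then have e: "0 < \<bar>I - J\<bar> / 2" by simp
  from assms(1)[unfolded has_rs_integral_def, rule_format, OF e]
  obtain d1 where "0 < d1" and d1: "\<forall>p. p tagged_division_of {a..b} \<and> (\<lambda>x. ball x d1) fine p \<longrightarrow>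
      \<bar>(\<Sum>(x, K)\<in>p. f x * (g (Sup K) - g (Inf K))) - I\<bar> < \<bar>I - J\<bar> / 2"
    by blast
  from assms(2)[unfolded has_rs_integral_def, rule_format, OF e]
  obtain d2 where "0 < d2" and d2: "\<forall>p. p tagged_division_of {a..b} \<and> (\<lambda>x. ball x d2) fine p \<longrightarrow>
      \<bar>(\<Sum>(x, K)\<in>p. f x * (g (Sup K) - g (Inf K))) - J\<bar> < \<bar>I - J\<bar> / 2"
    by blast
  have "0 < min d1 d2" using \<open>0 < d1\<close> \<open>0 < d2\<close> by simp
  then obtain p where p: "p tagged_division_of {a..b}" "(\<lambda>x. ball x (min d1 d2)) fine p"
    using fine_division_exists_real[OF gauge_ball] by metis
  then have "(\<lambda>x. ball x d1) fine p" "(\<lambda>x. ball x d2) fine p"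
    by (fastforce simp: fine_def)+
  with p(1) d1 d2 have "\<bar>(\<Sum>(x, K)\<in>p. f x * (g (Sup K) - g (Inf K))) - I\<bar> < \<bar>I - J\<bar> / 2"
    "\<bar>(\<Sum>(x, K)\<in>p. f x * (g (Sup K) - g (Inf K))) - J\<bar> < \<bar>I - J\<bar> / 2" by blast+
  then show False by (auto simp: abs_real_def split: if_splits)
qed

context control
begin

lemma stieltjes_rs_integral:
  assumes "stieltjes a b F f g" "a \<le> t" "t \<le> b"
  shows "rs_integral f g a t = F t - F a"
  unfolding rs_integral_def
  using stieltjes_has_rs_integral[OF assms] has_rs_integral_unique by blast

lemma stieltjes_unique:
  assumes "stieltjes a b F f g" "stieltjes a b F' f g" "a \<le> t" "t \<le> b"
  shows "F t - F a = F' t - F' a"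
  using assms stieltjes_rs_integral by metis

lemma stieltjes_factor:
  assumes G: "stieltjes a b G (\<lambda>x. h x * f x) g" and F: "stieltjes a b F f g"
    and h: "continuous_on {a..b} h"
  shows "stieltjes a b G h F"
proof -
  obtain K where "\<And>x. x \<in> {a..b} \<Longrightarrow> \<bar>h x\<bar> \<le> K" using continuous_bounded[OF h] by metis
  then have "negligible a b (\<lambda>s x t. h x * (F t - F s - f x * (g t - g s)))"
    by (intro negligible_mult[OF F[unfolded stieltjes_def], where K = K]) auto
  from negligible_diff[OF G[unfolded stieltjes_def] this] show ?thesis
    unfolding stieltjes_def by (rule negligible_cong) (simp add: algebra_simps)
qed

lemma product_rule:
  assumes "controlled a b F" "controlled a b G"
  shows "negligible a b (\<lambda>s x t. F t * G t - F s * G s - (F x * (G t - G s) + G x * (F t - F s)))"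
proof -
  have "negligible a b (\<lambda>s x t. (F s - F x) * (G t - G s))"
    by (rule negligible_oscillation[where p = "\<lambda>s x t. s" and q = "\<lambda>s x t. x"])
      (use assms controlled_continuous in auto)
  moreover have "negligible a b (\<lambda>s x t. (G t - G x) * (F t - F s))"
    by (rule negligible_oscillation[where p = "\<lambda>s x t. t" and q = "\<lambda>s x t. x"])
      (use assms controlled_continuous in auto)
  ultimately have "negligible a b (\<lambda>s x t. (F s - F x) * (G t - G s) + (G t - G x) * (F t - F s))"
    by (rule negligible_add)
  then show ?thesis by (rule negligible_cong) (simp add: algebra_simps)
qed

lemma stieltjes_bound:
  assumes F: "stieltjes a b F f g"
    and g: "\<And>s t. \<lbrakk>a \<le> s; s \<le> t; t \<le> b\<rbrakk> \<Longrightarrow> \<bar>g t - g s\<bar> \<le> C * (W t - W s)"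
    and f: "\<And>x. x \<in> {a..b} \<Longrightarrow> \<bar>f x\<bar> \<le> e" and "a \<le> s" "s \<le> t" "t \<le> b"
  shows "\<bar>F t - F s\<bar> \<le> e * C * (W t - W s)"
proof (rule increment_bound[where B = "\<lambda>s x t. f x * (g t - g s)"])
  show "negligible s t (\<lambda>s x t. F t - F s - f x * (g t - g s))"
    using stieltjes_subinterval[OF F \<open>a \<le> s\<close> \<open>t \<le> b\<close>] by (simp add: stieltjes_def)
  fix u x v assume *: "s \<le> u" "u \<le> x" "x \<le> v" "v \<le> t"
  then have x: "x \<in> {a..b}" using assms by auto
  have "\<bar>f x * (g v - g u)\<bar> \<le> e * (C * (W v - W u))"
    unfolding abs_mult
  proof (rule mult_mono)
    show "0 \<le> e" using f[OF x] by linarith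
  qed (use f[OF x] g[of u v] * assms in auto)
  then show "\<bar>f x * (g v - g u)\<bar> \<le> e * C * (W v - W u)" by simp
qed (use assms in auto)

text \<open>Continuity of \<open>F\<close> does not follow from the bound by \<open>W\<close>, which may jump. It comes from the continuity
of \<open>g\<close>, because the error term is at most a small multiple of the total increment of \<open>W\<close>.\<close>

lemma stieltjes_controlled:
  assumes F: "stieltjes a b F f g" and f: "continuous_on {a..b} f" and g: "controlled a b g"
    and "a \<le> b"
  shows "controlled a b F"
proof -
  obtain K where "0 \<le> K" and K: "\<And>x. x \<in> {a..b} \<Longrightarrow> \<bar>f x\<bar> \<le> K" using continuous_bounded[OF f] by metis
  obtain C where "0 \<le> C" and C: "\<And>s t. \<lbrakk>a \<le> s; s \<le> t; t \<le> b\<rbrakk> \<Longrightarrow> \<bar>g t - g s\<bar> \<le> C * (W t - W s)"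
    using controlledE[OF g] by metis
  have bound: "\<bar>F t - F s\<bar> \<le> (K * C) * (W t - W s)" if "a \<le> s" "s \<le> t" "t \<le> b" for s t
    using stieltjes_bound[OF F C K that] by simp
  have "uniformly_continuous_on {a..b} F"
    unfolding uniformly_continuous_on_def
  proof (intro allI impI)
    fix e :: real assume "0 < e"
    define V where "V = W b - W a + 1"
    have "0 < V" using increment_nonneg[OF \<open>a \<le> b\<close>] by (simp add: V_def)
    define \<epsilon> where "\<epsilon> = e / (2 * V)"
    have "0 < \<epsilon>" using \<open>0 < V\<close> \<open>0 < e\<close> by (simp add: \<epsilon>_def)
    from F[unfolded stieltjes_def negligible_def, rule_format, OF \<open>0 < \<epsilon>\<close>]
    obtain d1 where "0 < d1" and d1: "\<forall>s x t. a \<le> s \<longrightarrow> s \<le> x \<longrightarrow> x \<le> t \<longrightarrow> t \<le> b \<longrightarrow> t - s < d1 \<longrightarrow>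
        \<bar>F t - F s - f x * (g t - g s)\<bar> \<le> \<epsilon> * (W t - W s)"
      by blast
    have "uniformly_continuous_on {a..b} g"
      by (intro compact_uniformly_continuous controlled_continuous[OF g]) simp
    moreover have "0 < e / (2 * (K + 1))" using \<open>0 < e\<close> \<open>0 \<le> K\<close> by simp
    ultimately obtain d2 where "0 < d2" and d2:
      "\<And>x x'. \<lbrakk>x \<in> {a..b}; x' \<in> {a..b}; dist x' x < d2\<rbrakk> \<Longrightarrow> dist (g x') (g x) < e / (2 * (K + 1))"
      unfolding uniformly_continuous_on_def by metis
    have key: "\<bar>F t - F s\<bar> < e" if st: "a \<le> s" "s \<le> t" "t \<le> b" "t - s < min d1 d2" for s t
    proof -
      have "\<bar>F t - F s - f s * (g t - g s)\<bar> \<le> \<epsilon> * (W t - W s)" using d1[rule_format, of s s t] st by simp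
      also have "\<dots> \<le> \<epsilon> * V"
        using st increment_nonneg[of a s] increment_nonneg[of t b] \<open>0 < \<epsilon>\<close>
        by (intro mult_left_mono) (auto simp: V_def)
      also have "\<dots> = e / 2" using \<open>0 < V\<close> by (simp add: \<epsilon>_def)
      finally have 1: "\<bar>F t - F s - f s * (g t - g s)\<bar> \<le> e / 2" .
      have half: "k * (e / (2 * k)) = e / 2" if "k \<noteq> 0" for k using that by simp
      have "\<bar>f s * (g t - g s)\<bar> \<le> K * \<bar>g t - g s\<bar>"
        unfolding abs_mult using K[of s] st by (intro mult_right_mono) auto
      also have "\<dots> \<le> (K + 1) * \<bar>g t - g s\<bar>" by (simp add: algebra_simps)
      also have "\<dots> < (K + 1) * (e / (2 * (K + 1)))"
        using d2[of s t] st \<open>0 \<le> K\<close> by (intro mult_strict_left_mono) (auto simp: dist_real_def)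
      also have "\<dots> = e / 2" by (rule half) (use \<open>0 \<le> K\<close> in simp)
      finally show ?thesis using 1 by linarith
    qed
    show "\<exists>d>0. \<forall>x\<in>{a..b}. \<forall>x'\<in>{a..b}. dist x' x < d \<longrightarrow> dist (F x') (F x) < e"
    proof (intro exI[of _ "min d1 d2"] conjI ballI impI)
      fix x x' assume "x \<in> {a..b}" "x' \<in> {a..b}" "dist x' x < min d1 d2"
      then show "dist (F x') (F x) < e"
        using key[of x x'] key[of x' x] by (cases "x \<le> x'") (auto simp: dist_real_def abs_minus_commute)
    qed (use \<open>0 < d1\<close> \<open>0 < d2\<close> in simp)
  qed
  then have "continuous_on {a..b} F" by (rule uniformly_continuous_imp_continuous)
  with bound \<open>0 \<le> K\<close> \<open>0 \<le> C\<close> show ?thesis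
    unfolding controlled_def by (auto intro!: exI[of _ "K * C"])
qed

lemma stieltjes_deriv:
  assumes F: "\<And>x. x \<in> {a..b} \<Longrightarrow> (F has_real_derivative f x) (at x within {a..b})"
    and f: "continuous_on {a..b} f"
  shows "stieltjes a b F f (\<lambda>x. x)"
  unfolding stieltjes_def negligible_def
proof (intro allI impI)
  fix \<epsilon> :: real assume "0 < \<epsilon>"
  have "uniformly_continuous_on {a..b} f" by (intro compact_uniformly_continuous f) simp
  then obtain d where "0 < d" and d:
    "\<And>x x'. \<lbrakk>x \<in> {a..b}; x' \<in> {a..b}; dist x' x < d\<rbrakk> \<Longrightarrow> dist (f x') (f x) < \<epsilon>"
    using \<open>0 < \<epsilon>\<close> unfolding uniformly_continuous_on_def by metis
  have "\<bar>F t - F s - f x * (t - s)\<bar> \<le> \<epsilon> * (W t - W s)"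
    if *: "a \<le> s" "s \<le> x" "x \<le> t" "t \<le> b" "t - s < d" for s x t
  proof (cases "s < t")
    case True
    have "\<exists>z\<in>{s<..<t}. F t - F s = (*) (f z) (t - s)"
    proof (rule mvt_simple[OF True])
      fix x assume "s \<le> x" "x \<le> t"
      then have "(F has_real_derivative f x) (at x within {s..t})"
        by (intro has_field_derivative_subset[OF F]) (use * in auto)
      then show "(F has_derivative (*) (f x)) (at x within {s..t})"
        by (simp add: has_field_derivative_def)
    qed
    then obtain z where z: "s < z" "z < t" "F t - F s = f z * (t - s)" by auto
    then have "dist (f z) (f x) < \<epsilon>" using * by (intro d) (auto simp: dist_real_def)
    then have "\<bar>(f z - f x) * (t - s)\<bar> \<le> \<epsilon> * (t - s)"
      unfolding abs_mult using True by (intro mult_mono) (auto simp: dist_real_def)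
    also have "\<dots> \<le> \<epsilon> * (W t - W s)" using increment[of s t] True \<open>0 < \<epsilon>\<close> by simp
    finally show ?thesis using z(3) by (simp add: algebra_simps)
  next
    case False
    then have "t = s" "x = s" using * by auto
    then show ?thesis by simp
  qed
  with \<open>0 < d\<close> show "\<exists>\<delta>>0. \<forall>s x t. a \<le> s \<longrightarrow> s \<le> x \<longrightarrow> x \<le> t \<longrightarrow> t \<le> b \<longrightarrow> t - s < \<delta> \<longrightarrow>
      \<bar>F t - F s - f x * (t - s)\<bar> \<le> \<epsilon> * (W t - W s)" by blast
qed

text \<open>Integration by parts: \<open>f g\<close> minus the integral of \<open>g df\<close> has the differential \<open>f dg\<close>.\<close>

lemma stieltjes_exists_C1:
  assumes f: "\<And>x. x \<in> {a..b} \<Longrightarrow> (f has_real_derivative f' x) (at x within {a..b})"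
    and f': "continuous_on {a..b} f'" and g: "controlled a b g" and "a \<le> b"
  shows "\<exists>F. stieltjes a b F f g \<and> F a = 0"
proof -
  note cg = controlled_continuous[OF g]
  define J where "J = (\<lambda>t. integral {a..t} (\<lambda>s. g s * f' s))"
  have df: "stieltjes a b f f' (\<lambda>x. x)" by (rule stieltjes_deriv[OF f f'])
  \<comment> \<open>\<open>J\<close> is the integral of \<open>g df\<close>, because \<open>df = f' dt\<close>\<close>
  have "stieltjes a b J (\<lambda>x. g x * f' x) (\<lambda>x. x)"
    unfolding J_def
    by (intro stieltjes_deriv integral_has_real_derivative continuous_intros cg f')
  then have "stieltjes a b J g f" by (rule stieltjes_factor[OF _ df cg])
  moreover have "controlled a b f" by (rule stieltjes_controlled[OF df f' controlled_ident \<open>a \<le> b\<close>])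
  ultimately have "negligible a b (\<lambda>s x t. (f t * g t - f s * g s - (f x * (g t - g s) + g x * (f t - f s)))
      - (J t - J s - g x * (f t - f s)))"
    unfolding stieltjes_def by (intro negligible_diff[OF product_rule] g)
  then have "stieltjes a b (\<lambda>t. f t * g t - J t - f a * g a) f g"
    unfolding stieltjes_def by (rule negligible_cong) (simp add: algebra_simps)
  moreover have "J a = 0" by (simp add: J_def)
  ultimately show ?thesis by (intro exI[of _ "\<lambda>t. f t * g t - J t - f a * g a"]) simp
qed

text \<open>Approximate \<open>f\<close> uniformly by polynomials, to which integration by parts applies. If two integrands
differ by at most \<open>e\<close>, the increments of their integrals differ by at most a fixed multiple of \<open>e\<close> times
the increment of \<open>W\<close>. So the integrals converge, and their differentials with them.\<close>

lemma stieltjes_exists: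
  assumes f: "continuous_on {a..b} f" and g: "controlled a b g" and "a \<le> b"
  shows "\<exists>F. stieltjes a b F f g \<and> F a = 0"
proof -
  obtain C where "0 \<le> C" and C: "\<And>s t. \<lbrakk>a \<le> s; s \<le> t; t \<le> b\<rbrakk> \<Longrightarrow> \<bar>g t - g s\<bar> \<le> C * (W t - W s)"
    using controlledE[OF g] by metis
  have "\<exists>p F. (\<forall>x\<in>{a..b}. \<bar>f x - p x\<bar> < 1 / real (Suc n)) \<and> stieltjes a b F p g \<and> F a = 0" for n
  proof -
    obtain p where p: "real_polynomial_function p" "\<And>x. x \<in> {a..b} \<Longrightarrow> \<bar>f x - p x\<bar> < 1 / real (Suc n)"
      using Stone_Weierstrass_real_polynomial_function[of "{a..b}" f "1 / real (Suc n)"] f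
      by (metis compact_Icc of_nat_0_less_iff zero_less_Suc zero_less_divide_1_iff)
    obtain p' where p': "real_polynomial_function p'" "\<And>x. (p has_real_derivative p' x) (at x)"
      using has_real_derivative_polynomial_function[OF p(1)] by metis
    have "continuous_on {a..b} p'"
      using p'(1) by (intro continuous_on_polymonial_function) (simp add: real_polynomial_function_eq)
    with stieltjes_exists_C1[of a b p p' g] p'(2) g \<open>a \<le> b\<close>
    have "\<exists>F. stieltjes a b F p g \<and> F a = 0" using has_field_derivative_at_within by blast
    with p(2) show ?thesis by blast
  qed
  then obtain p F where p: "\<And>n x. x \<in> {a..b} \<Longrightarrow> \<bar>f x - p n x\<bar> < 1 / real (Suc n)"
    and F: "\<And>n. stieltjes a b (F n) (p n) g" and F0: "\<And>n. F n a = 0"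
    by metis
  have bound: "\<bar>(F n t - F m t) - (F n s - F m s)\<bar> \<le> 2 / real (Suc n) * C * (W t - W s)"
    if "n \<le> m" "a \<le> s" "s \<le> t" "t \<le> b" for n m s t
  proof (rule stieltjes_bound[OF stieltjes_diff[OF F F] C _ that(2-4)])
    fix x assume x: "x \<in> {a..b}"
    have "1 / real (Suc m) \<le> 1 / real (Suc n)" using that(1) by (simp add: frac_le)
    then show "\<bar>p n x - p m x\<bar> \<le> 2 / real (Suc n)"
      using p[OF x, of n] p[OF x, of m] by (simp only: abs_less_iff abs_le_iff) linarith
  qed
  have lim: "\<exists>l. (\<lambda>n. F n t) \<longlonglongrightarrow> l" if t: "t \<in> {a..b}" for t
  proof -
    have "Cauchy (\<lambda>n. F n t)"
    proof (rule metric_CauchyI)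
      fix e :: real assume "0 < e"
      define D where "D = 2 * (C * (W t - W a))"
      have "0 \<le> D" using t \<open>0 \<le> C\<close> increment_nonneg[of a t] by (simp add: D_def)
      obtain N where N: "(2 * D + 1) / e < real N" using reals_Archimedean2 by blast
      have "dist (F m t) (F n t) < e" if "N \<le> m" "N \<le> n" for m n
      proof -
        have *: "\<bar>F N t - F k t\<bar> \<le> D / real (Suc N)" if "N \<le> k" for k
          using bound[OF that, of a t] t by (simp add: F0 D_def)
        have "2 * D < e * real (Suc N)" using N \<open>0 < e\<close> by (simp add: field_simps)
        then have "2 * (D / real (Suc N)) < e" by (simp add: field_simps)
        with *[OF that(1)] *[OF that(2)] show ?thesis by (simp add: dist_real_def)
      qed
      then show "\<exists>N. \<forall>m\<ge>N. \<forall>n\<ge>N. dist (F m t) (F n t) < e" by blast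
    qed
    then show ?thesis by (simp add: convergent_eq_Cauchy[symmetric])
  qed
  define G where "G t = lim (\<lambda>n. F n t)" for t
  have G: "(\<lambda>n. F n t) \<longlonglongrightarrow> G t" if "t \<in> {a..b}" for t
    using lim[OF that] by (metis G_def limI)
  have boundG: "\<bar>(F n t - G t) - (F n s - G s)\<bar> \<le> 2 / real (Suc n) * C * (W t - W s)"
    if "a \<le> s" "s \<le> t" "t \<le> b" for n s t
  proof (rule tendsto_upperbound)
    show "(\<lambda>m. \<bar>(F n t - F m t) - (F n s - F m s)\<bar>) \<longlonglongrightarrow> \<bar>(F n t - G t) - (F n s - G s)\<bar>"
      using that by (intro tendsto_intros G) auto
    show "\<forall>\<^sub>F m in sequentially. \<bar>(F n t - F m t) - (F n s - F m s)\<bar> \<le> 2 / real (Suc n) * C * (W t - W s)"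
      using eventually_ge_at_top[of n] by eventually_elim (use bound that in blast)
  qed simp
  have "negligible a b (\<lambda>s x t. G t - G s - f x * (g t - g s))"
    unfolding negligible_def
  proof (intro allI impI)
    fix \<epsilon> :: real assume "0 < \<epsilon>"
    obtain n where n: "6 * C / \<epsilon> < real n" using reals_Archimedean2 by blast
    then have "3 * C / real (Suc n) \<le> \<epsilon> / 2" using \<open>0 < \<epsilon>\<close> by (simp add: field_simps)
    have "0 < \<epsilon> / 2" using \<open>0 < \<epsilon>\<close> by simp
    from F[of n, unfolded stieltjes_def negligible_def, rule_format, OF this]
    obtain d where "0 < d" and d: "\<forall>s x t. a \<le> s \<longrightarrow> s \<le> x \<longrightarrow> x \<le> t \<longrightarrow> t \<le> b \<longrightarrow> t - s < d \<longrightarrow>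
        \<bar>F n t - F n s - p n x * (g t - g s)\<bar> \<le> \<epsilon> / 2 * (W t - W s)"
      by blast
    have "\<bar>G t - G s - f x * (g t - g s)\<bar> \<le> \<epsilon> * (W t - W s)"
      if *: "a \<le> s" "s \<le> x" "x \<le> t" "t \<le> b" "t - s < d" for s x t
    proof -
      have w: "0 \<le> W t - W s" using * increment_nonneg by simp
      have 1: "\<bar>F n t - F n s - p n x * (g t - g s)\<bar> \<le> \<epsilon> / 2 * (W t - W s)" using d * by blast
      have 2: "\<bar>(F n t - G t) - (F n s - G s)\<bar> \<le> 2 / real (Suc n) * C * (W t - W s)"
        using boundG[of s t n] * by simp
      have "\<bar>(f x - p n x) * (g t - g s)\<bar> \<le> 1 / real (Suc n) * (C * (W t - W s))"
        unfolding abs_mult using p[of x n] C[of s t] * by (intro mult_mono) auto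
      moreover have "1 / real (Suc n) * (C * (W t - W s)) + 2 / real (Suc n) * C * (W t - W s)
          = 3 * C / real (Suc n) * (W t - W s)"
        by (simp add: field_simps del: of_nat_Suc)
      moreover have "3 * C / real (Suc n) * (W t - W s) \<le> \<epsilon> / 2 * (W t - W s)"
        by (rule mult_right_mono[OF \<open>3 * C / real (Suc n) \<le> \<epsilon> / 2\<close> w])
      moreover have "G t - G s - f x * (g t - g s) = (F n t - F n s - p n x * (g t - g s))
          - ((F n t - G t) - (F n s - G s)) - (f x - p n x) * (g t - g s)"
        by (simp add: algebra_simps)
      moreover have "\<epsilon> * (W t - W s) = \<epsilon> / 2 * (W t - W s) + \<epsilon> / 2 * (W t - W s)" by simp
      ultimately show ?thesis using 1 2 by linarith
    qed
    with \<open>0 < d\<close> show "\<exists>\<delta>>0. \<forall>s x t. a \<le> s \<longrightarrow> s \<le> x \<longrightarrow> x \<le> t \<longrightarrow> t \<le> b \<longrightarrow> t - s < \<delta> \<longrightarrow>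
        \<bar>G t - G s - f x * (g t - g s)\<bar> \<le> \<epsilon> * (W t - W s)" by blast
  qed
  moreover have "G a = 0" using G[of a] \<open>a \<le> b\<close> by (simp add: F0 LIMSEQ_const_iff)
  ultimately show ?thesis unfolding stieltjes_def by blast
qed

lemma stieltjes_power:
  assumes F: "controlled a b F" and "a \<le> b"
  shows "stieltjes a b (\<lambda>t. F t ^ Suc n / fact (Suc n)) (\<lambda>t. F t ^ n / fact n) F"
proof (induction n)
  case 0
  show ?case unfolding stieltjes_def by (rule negligible_cong[OF negligible_zero]) simp
next
  case (Suc n)
  let ?G = "\<lambda>t. F t ^ Suc n / fact (Suc n)"
  have "continuous_on {a..b} (\<lambda>t. F t ^ n / fact n)"
    by (intro continuous_intros controlled_continuous[OF F]) auto
  then have G: "controlled a b ?G" by (rule stieltjes_controlled[OF Suc _ F \<open>a \<le> b\<close>])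
  obtain K where K: "\<And>x. x \<in> {a..b} \<Longrightarrow> \<bar>F x\<bar> \<le> K"
    using continuous_bounded[OF controlled_continuous[OF F]] by metis
  have 1: "negligible a b (\<lambda>s x t. F x * (?G t - ?G s - F x ^ n / fact n * (F t - F s)))"
    by (rule negligible_mult[OF Suc[unfolded stieltjes_def], where K = K]) (use K in auto)
  have "negligible a b (\<lambda>s x t. 1 / real (Suc (Suc n)) *
      (F t * ?G t - F s * ?G s - (F x * (?G t - ?G s) + ?G x * (F t - F s))
        + F x * (?G t - ?G s - F x ^ n / fact n * (F t - F s))))"
    by (rule negligible_cmult[OF negligible_add[OF product_rule[OF F G] 1]])
  then show ?case
    unfolding stieltjes_def
  proof (rule negligible_cong)
    fix s x t
    define p where "p = ?G x * (F t - F s)"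
    have a: "F u ^ Suc (Suc n) / fact (Suc (Suc n)) = 1 / real (Suc (Suc n)) * (F u * ?G u)" for u
      by (simp add: field_simps)
    have "real (Suc n) * ?G x = F x * (F x ^ n / fact n)" by (simp del: of_nat_Suc)
    then have b: "F x * (F x ^ n / fact n * (F t - F s)) = real (Suc n) * p"
      unfolding p_def by (simp only: mult.assoc[symmetric])
    have "1 / real (Suc (Suc n)) * (F t * ?G t - F s * ?G s - (F x * (?G t - ?G s) + p)
        + F x * (?G t - ?G s - F x ^ n / fact n * (F t - F s)))
      = 1 / real (Suc (Suc n)) * (F t * ?G t - F s * ?G s - (p + real (Suc n) * p))"
      unfolding b[symmetric] by (simp add: algebra_simps)
    also have "p + real (Suc n) * p = real (Suc (Suc n)) * p" by (simp add: algebra_simps)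
    also have "1 / real (Suc (Suc n)) * (F t * ?G t - F s * ?G s - real (Suc (Suc n)) * p)
      = F t ^ Suc (Suc n) / fact (Suc (Suc n)) - F s ^ Suc (Suc n) / fact (Suc (Suc n)) - p"
      unfolding a by (simp only: right_diff_distrib) simp
    finally show "F t ^ Suc (Suc n) / fact (Suc (Suc n)) - F s ^ Suc (Suc n) / fact (Suc (Suc n))
        - ?G x * (F t - F s)
      = 1 / real (Suc (Suc n)) * (F t * ?G t - F s * ?G s - (F x * (?G t - ?G s) + ?G x * (F t - F s))
        + F x * (?G t - ?G s - F x ^ n / fact n * (F t - F s)))"
      unfolding p_def by (rule sym)
  qed
qed

text \<open>A continuous function of bounded variation is constant if its differential annihilates a ring of test
functions that is dense by the Stone--Weierstrass theorem.\<close>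

lemma constant_if_integrals_vanish:
  assumes "a < b" and G: "controlled a b G" and R: "function_ring_on R {a..b}"
    and vanish: "\<And>f. f \<in> R \<Longrightarrow> \<exists>F. stieltjes a b F f G \<and> F b = F a"
    and t: "t \<in> {a..b}"
  shows "G t = G a"
proof -
  interpret function_ring_on R "{a..b}" by (rule R)
  obtain F1 where F1: "stieltjes a b F1 (\<lambda>x. 1) G" "F1 b = F1 a" using vanish[OF const] by blast
  have GG: "stieltjes a b G (\<lambda>x. 1) G"
    unfolding stieltjes_def by (rule negligible_cong[OF negligible_zero]) simp
  have Gb: "G b = G a" using stieltjes_unique[OF F1(1) GG, of b] F1(2) \<open>a < b\<close> by simp
  \<comment> \<open>The test function is a primitive \<open>q\<close> of \<open>H = G - G a\<close>: since \<open>H\<close> vanishes at both ends,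
    the integral of \<open>q dG\<close> is minus the integral \<open>K b\<close> of \<open>H\<^sup>2 dt\<close>.\<close>
  define H where "H t = G t - G a" for t
  have H: "controlled a b H"
    using controlled_add[OF G controlled_const[of a b "- G a"]] by (simp add: H_def[abs_def])
  have cH: "continuous_on {a..b} H" by (rule controlled_continuous[OF H])
  define q where "q = (\<lambda>t. integral {a..t} H)"
  define K where "K = (\<lambda>t. integral {a..t} (\<lambda>x. H x * H x))"
  have dq: "stieltjes a b q H (\<lambda>x. x)"
    unfolding q_def by (intro stieltjes_deriv integral_has_real_derivative cH)
  have q: "controlled a b q" using stieltjes_controlled[OF dq cH controlled_ident] \<open>a < b\<close> by simp
  have "stieltjes a b K (\<lambda>x. H x * H x) (\<lambda>x. x)"
    unfolding K_def by (intro stieltjes_deriv integral_has_real_derivative continuous_intros cH)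
  then have dK: "stieltjes a b K H q" by (rule stieltjes_factor[OF _ dq cH])
  have "negligible a b (\<lambda>s x t. (q t * H t - q s * H s - (q x * (H t - H s) + H x * (q t - q s)))
      - (K t - K s - H x * (q t - q s)))"
    by (rule negligible_diff[OF product_rule[OF q H] dK[unfolded stieltjes_def]])
  then have F0: "stieltjes a b (\<lambda>t. q t * H t - K t) q G"
    unfolding stieltjes_def by (rule negligible_cong) (simp add: H_def algebra_simps)
  obtain C where C: "0 \<le> C" "\<And>s t. \<lbrakk>a \<le> s; s \<le> t; t \<le> b\<rbrakk> \<Longrightarrow> \<bar>G t - G s\<bar> \<le> C * (W t - W s)"
    using controlledE[OF G] by metis
  define D where "D = C * (W b - W a)"
  have "0 \<le> D" using C(1) increment_nonneg[of a b] \<open>a < b\<close> by (simp add: D_def)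
  have "\<bar>K b\<bar> \<le> 0 + e" if "0 < e" for e
  proof -
    have e: "0 < e / (D + 1)" using that \<open>0 \<le> D\<close> by simp
    obtain f where f: "f \<in> R" "\<And>x. x \<in> {a..b} \<Longrightarrow> \<bar>q x - f x\<bar> < e / (D + 1)"
      using Stone_Weierstrass_basic[OF controlled_continuous[OF q] e] by blast
    obtain F where F: "stieltjes a b F f G" "F b = F a" using vanish[OF f(1)] by blast
    have "\<bar>(q b * H b - K b - F b) - (q a * H a - K a - F a)\<bar> \<le> e / (D + 1) * C * (W b - W a)"
      by (rule stieltjes_bound[OF stieltjes_diff[OF F0 F(1)] C(2)])
        (use f(2) \<open>a < b\<close> in \<open>auto intro: less_imp_le\<close>)
    moreover have "H b = 0" "H a = 0" "K a = 0" using Gb by (simp_all add: H_def K_def)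
    ultimately have "\<bar>K b\<bar> \<le> e / (D + 1) * D" using F(2) by (simp add: D_def mult.assoc)
    also have "\<dots> \<le> e / (D + 1) * (D + 1)" using e by (intro mult_left_mono) auto
    finally show ?thesis using \<open>0 \<le> D\<close> by simp
  qed
  then have "K b = 0" using field_le_epsilon[of "\<bar>K b\<bar>" 0] by simp
  then have "\<forall>x\<in>{a..b}. H x * H x = 0"
    unfolding K_def
    by (subst (asm) integral_eq_0_iff) (use \<open>a < b\<close> cH in \<open>auto intro!: continuous_intros\<close>)
  then have "H t * H t = 0" using t by blast
  then show ?thesis by (simp add: H_def)
qed

end

section \<open>The control of a path of bounded variation\<close>

text \<open>The control is \<open>t\<close> plus the variation of \<open>\<gamma>\<close> on \<open>[a, t]\<close>.\<close>

lemma bounded_variation_control: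
  assumes "bounded_variation_on \<gamma> a b" "a \<le> b"
  obtains W where "control W"
    "\<And>s t. \<lbrakk>a \<le> s; s \<le> t; t \<le> b\<rbrakk> \<Longrightarrow> norm (\<gamma> t - \<gamma> s) \<le> W t - W s"
proof -
  define S where "S D = (\<Sum>K\<in>D. norm (\<gamma> (Sup K) - \<gamma> (Inf K)))" for D
  obtain B where B: "\<And>D. D division_of {a..b} \<Longrightarrow> S D \<le> B"
    using assms(1) unfolding bounded_variation_on_def S_def by blast
  define V where "V t = (SUP D\<in>{D. D division_of {a..t}}. S D)" for t
  have ext: "insert {s..t} D division_of {a..t} \<and> S (insert {s..t} D) = norm (\<gamma> t - \<gamma> s) + S D"
    if D: "D division_of {a..s}" and st: "a \<le> s" "s < t" for D s t
  proof
    have "{s..t} \<notin> D" using division_ofD(2)[OF D, of "{s..t}"] st by auto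
    then show "S (insert {s..t} D) = norm (\<gamma> t - \<gamma> s) + S D"
      unfolding S_def using division_ofD(1)[OF D] st by simp
    have "{{s..t}} division_of {s..t}" using division_of_self[of s t] st by simp
    then have "D \<union> {{s..t}} division_of {a..s} \<union> {s..t}"
      by (rule division_disjoint_union[OF D]) simp
    moreover have "{a..s} \<union> {s..t} = {a..t}" using st by auto
    ultimately show "insert {s..t} D division_of {a..t}" by simp
  qed
  have bdd: "bdd_above (S ` {D. D division_of {a..t}})" if t: "a \<le> t" "t \<le> b" for t
  proof (rule bdd_aboveI2)
    fix D assume "D \<in> {D. D division_of {a..t}}"
    then have D: "D division_of {a..t}" by simp
    show "S D \<le> B"
    proof (cases "t = b")
      case False
      then have "insert {t..b} D division_of {a..b} \<and> S (insert {t..b} D) = norm (\<gamma> b - \<gamma> t) + S D"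
        using t D by (intro ext) auto
      then show ?thesis using B[of "insert {t..b} D"] norm_ge_zero[of "\<gamma> b - \<gamma> t"] by linarith
    qed (use D B in simp)
  qed
  have V: "norm (\<gamma> t - \<gamma> s) \<le> V t - V s" if st: "a \<le> s" "s \<le> t" "t \<le> b" for s t
  proof (cases "s = t")
    case False
    then have "s < t" using st by simp
    have "V s \<le> V t - norm (\<gamma> t - \<gamma> s)"
      unfolding V_def[of s]
    proof (rule cSUP_least)
      show "{D. D division_of {a..s}} \<noteq> {}" using division_of_self[of a s] st by auto
      fix D assume "D \<in> {D. D division_of {a..s}}"
      then have *: "insert {s..t} D division_of {a..t} \<and> S (insert {s..t} D) = norm (\<gamma> t - \<gamma> s) + S D"
        using st \<open>s < t\<close> by (intro ext) auto
      then have "S (insert {s..t} D) \<le> V t"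
        unfolding V_def using st by (intro cSUP_upper bdd) auto
      with * show "S D \<le> V t - norm (\<gamma> t - \<gamma> s)" by simp
    qed
    then show ?thesis by simp
  qed simp
  \<comment> \<open>a control has to increase on the whole line, so \<open>V\<close> is continued by constants\<close>
  define c where "c t = max a (min b t)" for t
  define W where "W t = t + V (c t)" for t
  show thesis
  proof
    show "control W"
    proof
      fix s t :: real assume "s \<le> t"
      then have "a \<le> c s" "c s \<le> c t" "c t \<le> b" using assms(2) by (auto simp: c_def)
      then have "0 \<le> V (c t) - V (c s)" using V norm_ge_zero order_trans by blast
      then show "t - s \<le> W t - W s" by (simp add: W_def)
    qed
    fix s t assume st: "a \<le> s" "s \<le> t" "t \<le> b"
    then have "c s = s" "c t = t" by (auto simp: c_def)
    then show "norm (\<gamma> t - \<gamma> s) \<le> W t - W s" using V[OF st] st by (simp add: W_def)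
  qed
qed

section \<open>Tensor series: product, powers, exponential and logarithm\<close>

lemma tprod_Nil: "tprod A B [] = A [] * B []"
  by (simp add: tprod_def)

text \<open>Taking the first letter off the words is a twisted derivation of the tensor product. With this
rule the algebraic laws follow by induction on the word.\<close>

lemma tprod_Cons: "tprod A B (i # w) = A [] * B (i # w) + tprod (\<lambda>u. A (i # u)) B w"
  by (simp add: tprod_def sum.atMost_Suc_shift del: sum.atMost_Suc)

lemma tprod_add_left: "tprod (\<lambda>w. A w + B w) C w = tprod A C w + tprod B C w"
  by (simp add: tprod_def distrib_right sum.distrib)

lemma tprod_scale_left: "tprod (\<lambda>w. c * A w) C w = c * tprod A C w"
  by (simp add: tprod_def sum_distrib_left mult.assoc)

lemma tprod_assoc: "tprod (tprod A B) C = tprod A (tprod B C)"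
proof
  fix w show "tprod (tprod A B) C w = tprod A (tprod B C) w"
  proof (induction w arbitrary: A)
    case (Cons i w)
    have "(\<lambda>u. tprod A B (i # u)) = (\<lambda>u. A [] * B (i # u) + tprod (\<lambda>u. A (i # u)) B u)"
      by (simp add: tprod_Cons)
    then show ?case
      by (simp add: tprod_Cons tprod_Nil tprod_add_left tprod_scale_left Cons.IH algebra_simps)
  qed (simp add: tprod_Nil)
qed

lemma tprod_tone_left [simp]: "tprod tone A = A"
proof
  fix w show "tprod tone A w = A w"
    by (cases w) (simp_all add: tprod_Nil tprod_Cons, simp_all add: tone_def tprod_def)
qed

lemma tprod_tone_right [simp]: "tprod A tone = A"
proof
  fix w show "tprod A tone w = A w"
    by (induction w arbitrary: A) (simp_all add: tprod_Nil tprod_Cons, simp_all add: tone_def)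
qed

lemma tpow_add: "tprod (tpow A m) (tpow A n) = tpow A (m + n)"
  by (induction m) (simp_all add: tprod_assoc)

lemma tpow_vanish: "\<lbrakk>A [] = 0; length w < n\<rbrakk> \<Longrightarrow> tpow A n w = 0"
proof (induction n arbitrary: w)
  case (Suc n)
  have "A (take m w) * tpow A n (drop m w) = 0" if "m \<le> length w" for m
  proof (cases "m = 0")
    case False
    then have "length (drop m w) < n" using Suc.prems that by simp
    then show ?thesis using Suc by simp
  qed (use Suc in simp)
  then have "(\<Sum>m\<le>length w. A (take m w) * tpow A n (drop m w)) = 0" by (intro sum.neutral) blast
  then show ?case by (simp add: tprod_def)
qed simp

text \<open>The value of a power series \<open>f\<close> in one variable at a tensor series \<open>x\<close> without constant term. At a word
\<open>w\<close> the powers above \<open>length w\<close> vanish. As \<open>f \<mapsto> f(x)\<close> respects products and composition, identities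
between \<open>exp\<close> and \<open>log\<close> can be proved for ordinary power series.\<close>

definition series_at :: "real fps \<Rightarrow> 'd tensor_series \<Rightarrow> 'd tensor_series" where
  "series_at f x = (\<lambda>w. \<Sum>n\<le>length w. fps_nth f n * tpow x n w)"

lemma series_at_upto:
  assumes "x [] = 0" "length w \<le> N"
  shows "series_at f x w = (\<Sum>n\<le>N. fps_nth f n * tpow x n w)"
  unfolding series_at_def
  by (rule sum.mono_neutral_left) (use assms tpow_vanish[of x w] in auto)

lemma series_at_Nil [simp]: "series_at f x [] = fps_nth f 0"
  by (simp add: series_at_def tone_def)

lemma series_at_1 [simp]: "series_at 1 x = tone"
proof
  fix w :: "'a list"
  have "series_at 1 x w = (\<Sum>n\<le>length w. if n = 0 then tone w else 0)"
    unfolding series_at_def by (intro sum.cong) auto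
  then show "series_at 1 x w = tone w" by simp
qed

lemma series_at_X: "x [] = 0 \<Longrightarrow> series_at fps_X x = x"
proof
  fix w :: "'a list" assume x: "x [] = 0"
  have "series_at fps_X x w = (\<Sum>n\<le>Suc (length w). if n = 1 then x w else 0)"
    unfolding series_at_upto[of x w "Suc (length w)" fps_X, OF x le_SucI[OF order.refl]]
    by (intro sum.cong) auto
  then show "series_at fps_X x w = x w" by (simp del: sum.atMost_Suc)
qed

lemma series_at_add: "series_at (f + g) x w = series_at f x w + series_at g x w"
  by (simp add: series_at_def algebra_simps sum.distrib)

lemma series_at_diff: "series_at (f - g) x w = series_at f x w - series_at g x w"
  by (simp add: series_at_def algebra_simps sum_subtractf)

lemma series_at_mult:
  assumes x: "x [] = 0"
  shows "tprod (series_at f x) (series_at g x) = series_at (f * g) x"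
proof
  fix w :: "'a list"
  define N where "N = length w"
  have "tprod (series_at f x) (series_at g x) w
      = (\<Sum>m\<le>N. (\<Sum>j\<le>N. fps_nth f j * tpow x j (take m w)) * (\<Sum>k\<le>N. fps_nth g k * tpow x k (drop m w)))"
    unfolding tprod_def N_def using x
    by (intro sum.cong arg_cong2[where f = "(*)"] series_at_upto) auto
  also have "\<dots> = (\<Sum>m\<le>N. \<Sum>j\<le>N. \<Sum>k\<le>N. fps_nth f j * fps_nth g k * (tpow x j (take m w) * tpow x k (drop m w)))"
    by (simp add: sum_product mult.assoc mult.left_commute)
  also have "\<dots> = (\<Sum>j\<le>N. \<Sum>k\<le>N. \<Sum>m\<le>N. fps_nth f j * fps_nth g k * (tpow x j (take m w) * tpow x k (drop m w)))"
    by (subst sum.swap, rule sum.cong[OF refl], rule sum.swap)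
  also have "\<dots> = (\<Sum>j\<le>N. \<Sum>k\<le>N. fps_nth f j * fps_nth g k * tpow x (j + k) w)"
    by (simp add: sum_distrib_left[symmetric] tpow_add[symmetric] tprod_def N_def)
  also have "\<dots> = (\<Sum>(j, k)\<in>{..N} \<times> {..N}. fps_nth f j * fps_nth g k * tpow x (j + k) w)"
    by (simp add: sum.cartesian_product)
  also have "\<dots> = (\<Sum>(j, k)\<in>{(j, k). j + k \<le> N}. fps_nth f j * fps_nth g k * tpow x (j + k) w)"
  proof (rule sum.mono_neutral_right)
    show "\<forall>jk\<in>{..N} \<times> {..N} - {(j, k). j + k \<le> N}.
        (case jk of (j, k) \<Rightarrow> fps_nth f j * fps_nth g k * tpow x (j + k) w) = 0"
      using x tpow_vanish[of x w] by (auto simp: N_def) (meson not_le)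
  qed auto
  also have "\<dots> = (\<Sum>n\<le>N. \<Sum>j\<le>n. fps_nth f j * fps_nth g (n - j) * tpow x n w)"
    by (subst sum.triangle_reindex_eq) simp
  also have "\<dots> = series_at (f * g) x w"
    by (simp add: series_at_def N_def fps_mult_nth sum_distrib_right atLeast0AtMost)
  finally show "tprod (series_at f x) (series_at g x) w = series_at (f * g) x w" .
qed

lemma tpow_series_at: "x [] = 0 \<Longrightarrow> tpow (series_at g x) n = series_at (g ^ n) x"
  by (induction n) (simp_all add: series_at_mult)

lemma series_at_compose:
  assumes "x [] = 0" "fps_nth g 0 = 0"
  shows "series_at f (series_at g x) = series_at (f oo g) x"
proof
  fix w :: "'a list"
  have 0: "fps_nth (g ^ n) m = 0" if "m < n" for m n
    using startsby_zero_power_prefix[OF assms(2)] that by blast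
  have "series_at f (series_at g x) w
      = (\<Sum>n\<le>length w. \<Sum>m\<le>length w. fps_nth f n * fps_nth (g ^ n) m * tpow x m w)"
    unfolding series_at_def[of f] using assms
    by (simp add: tpow_series_at) (simp add: series_at_def sum_distrib_left mult.assoc)
  also have "\<dots> = (\<Sum>m\<le>length w. \<Sum>n\<le>length w. fps_nth f n * fps_nth (g ^ n) m * tpow x m w)"
    by (rule sum.swap)
  also have "\<dots> = (\<Sum>m\<le>length w. \<Sum>n\<le>m. fps_nth f n * fps_nth (g ^ n) m * tpow x m w)"
    by (intro sum.cong refl sum.mono_neutral_right) (auto simp: 0)
  also have "\<dots> = series_at (f oo g) x w"
    by (simp add: series_at_def fps_compose_nth sum_distrib_right atLeast0AtMost)
  finally show "series_at f (series_at g x) w = series_at (f oo g) x w" .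
qed

lemma tlog_series_at:
  assumes "A [] = 1"
  shows "tlog A = series_at (fps_ln 1) (tminus A tone)"
proof
  fix w :: "'a list"
  define x where "x = tminus A tone"
  have x: "x [] = 0" using assms by (simp add: x_def tminus_def tone_def)
  have "tlog A w = (\<Sum>n<length w. (-1) ^ n / real (Suc n) * tpow x (Suc n) w)"
    unfolding tlog_def x_def[symmetric]
  proof (rule suminf_finite)
    fix n assume "n \<notin> {..<length w}"
    then have "tpow x (Suc n) w = 0" using x by (intro tpow_vanish) auto
    then show "(-1) ^ n / real (Suc n) * tpow x (Suc n) w = 0" by simp
  qed simp
  also have "\<dots> = (\<Sum>n<length w. fps_nth (fps_ln 1) (Suc n) * tpow x (Suc n) w)"
    by (simp add: fps_ln_nth)
  also have "\<dots> = series_at (fps_ln 1) x w"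
    by (simp add: series_at_def lessThan_Suc_atMost[symmetric] sum.lessThan_Suc_shift del: sum.lessThan_Suc)
  finally show "tlog A w = series_at (fps_ln 1) (tminus A tone) w" by (simp add: x_def)
qed

lemma fps_exp_ln: "(fps_exp (1::real) - 1) oo fps_ln 1 = fps_X"
  using fps_inv_right[of "fps_exp (1::real) - 1"] by (simp add: fps_ln_fps_exp_inv)

lemma fps_ln_exp: "fps_ln (1::real) oo (fps_exp 1 - 1) = fps_X"
  using fps_inv[of "fps_exp (1::real) - 1"] by (simp add: fps_ln_fps_exp_inv)

lemma exp_tlog:
  assumes "A [] = 1"
  shows "series_at (fps_exp 1) (tlog A) = A"
proof -
  have x: "tminus A tone [] = 0" using assms by (simp add: tminus_def tone_def)
  have "fps_exp (1::real) = (fps_exp 1 - 1) + 1" by simp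
  then have "fps_exp (1::real) oo fps_ln 1 = fps_X + 1"
    by (metis fps_compose_1 fps_compose_add_distrib fps_exp_ln)
  then have "series_at (fps_exp 1) (tlog A) = series_at (fps_X + 1) (tminus A tone)"
    using x by (simp add: tlog_series_at[where A = A, OF assms] series_at_compose)
  also have "\<dots> = A" using series_at_X[of "tminus A tone"] x
    by (simp add: fun_eq_iff series_at_add tminus_def)
  finally show ?thesis .
qed

lemma tlog_exp:
  assumes "x [] = 0"
  shows "tlog (series_at (fps_exp 1) x) = x"
proof -
  have "tminus (series_at (fps_exp 1) x) tone = series_at (fps_exp 1 - 1) x"
    by (simp add: tminus_def fun_eq_iff series_at_diff)
  then show ?thesis
    using assms by (simp add: tlog_series_at series_at_compose fps_ln_exp series_at_X)
qed

lemma tprod_right_cancel: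
  assumes "X [] = 1" "tprod Y X = X"
  shows "Y = tone"
proof -
  define x where "x = tminus X tone"
  have x: "x [] = 0" using assms by (simp add: x_def tminus_def tone_def)
  \<comment> \<open>\<open>X\<close> has a right inverse, the geometric series in \<open>x = X - 1\<close>\<close>
  have "X = series_at (1 + fps_X) x"
    using series_at_X[of x] x by (simp add: fun_eq_iff series_at_add) (simp add: x_def tminus_def)
  then have inv: "tprod X (series_at (inverse (1 + fps_X)) x) = tone"
    using x by (simp add: series_at_mult inverse_mult_eq_1')
  have "Y = tprod Y (tprod X (series_at (inverse (1 + fps_X)) x))" by (simp add: inv)
  also have "\<dots> = tprod (tprod Y X) (series_at (inverse (1 + fps_X)) x)"
    by (simp only: tprod_assoc)
  also have "\<dots> = tone" by (simp only: assms(2) inv)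
  finally show ?thesis .
qed

text \<open>Iterated integrals are defined on reversed words, and reversal is an anti-automorphism of the tensor
product. As it commutes with powers of a single series, it commutes with the logarithm.\<close>

lemma tprod_rev: "tprod (\<lambda>u. A (rev u)) (\<lambda>u. B (rev u)) w = tprod B A (rev w)"
  unfolding tprod_def
  by (rule sum.reindex_bij_witness[where i = "\<lambda>n. length w - n" and j = "\<lambda>n. length w - n"])
    (auto simp: rev_take rev_drop)

lemma tpow_rev: "tpow (\<lambda>u. A (rev u)) n w = tpow A n (rev w)"
proof (induction n arbitrary: w)
  case (Suc n)
  have "tpow (\<lambda>u. A (rev u)) n = (\<lambda>u. tpow A n (rev u))" using Suc by blast
  then have "tpow (\<lambda>u. A (rev u)) (Suc n) w = tprod (tpow A n) (tpow A 1) (rev w)"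
    by (simp add: tprod_rev)
  then show ?case by (simp add: tpow_add del: One_nat_def tpow.simps) simp
qed (simp add: tone_def)

lemma tlog_rev: "tlog (\<lambda>u. A (rev u)) w = tlog A (rev w)"
proof -
  have "tminus (\<lambda>u. A (rev u)) tone = (\<lambda>u. tminus A tone (rev u))"
    by (simp add: tminus_def tone_def fun_eq_iff)
  then show ?thesis unfolding tlog_def by (simp only: tpow_rev)
qed

section \<open>The shuffle algebra\<close>

text \<open>The coefficients of the shuffle product of \<open>a\<close> and \<open>b\<close>. The recursion says that taking off the first
letter is a derivation; together with the value at the empty word this determines the product.\<close>

primrec shuffle_coef :: "'d list \<Rightarrow> ('d list \<Rightarrow> real) \<Rightarrow> ('d list \<Rightarrow> real) \<Rightarrow> real" where
  "shuffle_coef [] a b = a [] * b []"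
| "shuffle_coef (i # w) a b = shuffle_coef w (\<lambda>u. a (i # u)) b + shuffle_coef w a (\<lambda>u. b (i # u))"

lemma shuffle_coef_commute: "shuffle_coef w a b = shuffle_coef w b a"
  by (induction w arbitrary: a b) simp_all

lemma shuffle_coef_add: "shuffle_coef w (\<lambda>u. a u + a' u) b = shuffle_coef w a b + shuffle_coef w a' b"
  by (induction w arbitrary: a a' b) (simp_all add: algebra_simps)

lemma shuffle_coef_scale: "shuffle_coef w (\<lambda>u. c * a u) b = c * shuffle_coef w a b"
  by (induction w arbitrary: a b) (simp_all add: algebra_simps)

lemma shuffle_coef_zero: "shuffle_coef w (\<lambda>u. 0) b = 0"
  using shuffle_coef_scale[of w 0 "\<lambda>u. 0" b] by simp

lemma shuffle_coef_tone: "shuffle_coef w tone b = b w"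
proof (induction w arbitrary: b)
  case (Cons i w)
  have "(\<lambda>u. tone (i # u)) = (\<lambda>u. 0)" by (simp add: tone_def)
  with Cons show ?case by (simp add: shuffle_coef_zero)
qed (simp add: tone_def)

lemma shuffle_coef_assoc: "shuffle_coef w (\<lambda>u. shuffle_coef u a b) c = shuffle_coef w a (\<lambda>u. shuffle_coef u b c)"
proof (induction w arbitrary: a b c)
  case (Cons i w)
  have r: "shuffle_coef w a (\<lambda>u. f u + g u) = shuffle_coef w a f + shuffle_coef w a g" for a f g
    using shuffle_coef_add[of w f g a] by (simp add: shuffle_coef_commute)
  show ?case by (simp add: shuffle_coef_add r Cons.IH)
qed simp

lemma shuffle_coef_vanish:
  assumes "\<And>w. m \<le> length w \<Longrightarrow> a w = 0" "\<And>w. n \<le> length w \<Longrightarrow> b w = 0" "m + n \<le> length w"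
  shows "shuffle_coef w a b = 0"
  using assms
proof (induction w arbitrary: a b m n)
  case (Cons i w)
  have "shuffle_coef w (\<lambda>u. a (i # u)) b = 0"
  proof (cases m)
    case 0
    then have "(\<lambda>u. a (i # u)) = (\<lambda>u. 0)" using Cons.prems(1) by auto
    then show ?thesis by (simp only: shuffle_coef_zero)
  next
    case (Suc m')
    show ?thesis by (rule Cons.IH[of m' _ n]) (use Cons.prems Suc in auto)
  qed
  moreover have "shuffle_coef w (\<lambda>u. b (i # u)) a = 0"
  proof (cases n)
    case 0
    then have "(\<lambda>u. b (i # u)) = (\<lambda>u. 0)" using Cons.prems(2) by auto
    then show ?thesis by (simp only: shuffle_coef_zero)
  next
    case (Suc n')
    show ?thesis by (rule Cons.IH[of n' _ m]) (use Cons.prems Suc in auto)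
  qed
  ultimately show ?case by (simp add: shuffle_coef_commute)
qed simp

text \<open>Elements are functions on words that vanish on all long words. Over a finite alphabet they are the
finite linear combinations of words, that is, linear functionals on tensor series.\<close>

typedef 'd shuffle = "{a :: 'd list \<Rightarrow> real. \<exists>n. \<forall>w. n \<le> length w \<longrightarrow> a w = 0}"
  morphisms coef Shuffle
  by (rule exI[of _ "\<lambda>w. 0"]) simp

setup_lifting type_definition_shuffle

lemma shuffle_eqI: "(\<And>w. coef a w = coef b w) \<Longrightarrow> a = b"
  by (simp add: coef_inject[symmetric] fun_eq_iff)

instantiation shuffle :: (type) "{comm_ring_1, real_algebra_1}"
begin

lift_definition zero_shuffle :: "'a shuffle" is "\<lambda>w. 0" by simp

lift_definition one_shuffle :: "'a shuffle" is tone
  by (rule exI[of _ 1]) (auto simp: tone_def)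

lift_definition plus_shuffle :: "'a shuffle \<Rightarrow> 'a shuffle \<Rightarrow> 'a shuffle" is "\<lambda>a b w. a w + b w"
proof -
  fix a b :: "'a list \<Rightarrow> real"
  assume "\<exists>n. \<forall>w. n \<le> length w \<longrightarrow> a w = 0" "\<exists>n. \<forall>w. n \<le> length w \<longrightarrow> b w = 0"
  then obtain m n where "\<forall>w. m \<le> length w \<longrightarrow> a w = 0" "\<forall>w. n \<le> length w \<longrightarrow> b w = 0" by blast
  then show "\<exists>n. \<forall>w. n \<le> length w \<longrightarrow> a w + b w = 0" by (intro exI[of _ "max m n"]) simp
qed

lift_definition minus_shuffle :: "'a shuffle \<Rightarrow> 'a shuffle \<Rightarrow> 'a shuffle" is "\<lambda>a b w. a w - b w"
proof -
  fix a b :: "'a list \<Rightarrow> real"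
  assume "\<exists>n. \<forall>w. n \<le> length w \<longrightarrow> a w = 0" "\<exists>n. \<forall>w. n \<le> length w \<longrightarrow> b w = 0"
  then obtain m n where "\<forall>w. m \<le> length w \<longrightarrow> a w = 0" "\<forall>w. n \<le> length w \<longrightarrow> b w = 0" by blast
  then show "\<exists>n. \<forall>w. n \<le> length w \<longrightarrow> a w - b w = 0" by (intro exI[of _ "max m n"]) simp
qed

lift_definition uminus_shuffle :: "'a shuffle \<Rightarrow> 'a shuffle" is "\<lambda>a w. - a w" by simp

lift_definition scaleR_shuffle :: "real \<Rightarrow> 'a shuffle \<Rightarrow> 'a shuffle" is "\<lambda>c a w. c * a w"
  by (metis mult_zero_right)

lift_definition times_shuffle :: "'a shuffle \<Rightarrow> 'a shuffle \<Rightarrow> 'a shuffle" is "\<lambda>a b w. shuffle_coef w a b"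
proof -
  fix a b :: "'a list \<Rightarrow> real"
  assume "\<exists>n. \<forall>w. n \<le> length w \<longrightarrow> a w = 0" "\<exists>n. \<forall>w. n \<le> length w \<longrightarrow> b w = 0"
  then obtain m n where "\<forall>w. m \<le> length w \<longrightarrow> a w = 0" "\<forall>w. n \<le> length w \<longrightarrow> b w = 0" by blast
  then have "\<forall>w. m + n \<le> length w \<longrightarrow> shuffle_coef w a b = 0" using shuffle_coef_vanish[of m a n b] by blast
  then show "\<exists>n. \<forall>w. n \<le> length w \<longrightarrow> shuffle_coef w a b = 0" by blast
qed

instance
proof
  fix a b c :: "'a shuffle" and x y :: real
  show "a * b * c = a * (b * c)" by transfer (simp add: shuffle_coef_assoc)
  show comm: "a * b = b * a" for a b :: "'a shuffle" by transfer (simp add: shuffle_coef_commute fun_eq_iff)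
  show "1 * a = a" by transfer (simp add: shuffle_coef_tone)
  then show "a * 1 = a" by (simp only: comm)
  show distrib: "(a + b) * c = a * c + b * c" for a b c :: "'a shuffle" by transfer (simp add: shuffle_coef_add)
  show "a * (b + c) = a * b + a * c" by (simp only: comm[of a] distrib)
  show "(0::'a shuffle) \<noteq> 1" by transfer (auto simp: tone_def fun_eq_iff)
  show "x *\<^sub>R a * b = x *\<^sub>R (a * b)" by transfer (simp add: shuffle_coef_scale)
  show "a * x *\<^sub>R b = x *\<^sub>R (a * b)"
  proof transfer
    fix a b :: "'a list \<Rightarrow> real" and x :: real
    show "(\<lambda>w. shuffle_coef w a (\<lambda>w. x * b w)) = (\<lambda>w. x * shuffle_coef w a b)"
      using shuffle_coef_scale[of _ x b a] by (simp add: shuffle_coef_commute[of _ a] fun_eq_iff)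
  qed
  show "a + b + c = a + (b + c)" "a + b = b + a" "0 + a = a" "- a + a = 0" "a - b = a + - b"
    "x *\<^sub>R (a + b) = x *\<^sub>R a + x *\<^sub>R b" "(x + y) *\<^sub>R a = x *\<^sub>R a + y *\<^sub>R a"
    "x *\<^sub>R y *\<^sub>R a = (x * y) *\<^sub>R a" "1 *\<^sub>R a = a"
    by (transfer; simp add: algebra_simps fun_eq_iff)+
qed

end

lemma coef_simps [simp]:
  "coef 0 w = 0" "coef 1 w = tone w" "coef (a + b) w = coef a w + coef b w"
  "coef (a - b) w = coef a w - coef b w" "coef (c *\<^sub>R a) w = c * coef a w"
  by (transfer; simp)+

lemma coef_mult_Nil [simp]: "coef (a * b) [] = coef a [] * coef b []"
  by transfer simp

lift_definition letter_deriv :: "'d \<Rightarrow> 'd shuffle \<Rightarrow> 'd shuffle" is "\<lambda>i a u. a (i # u)"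
proof -
  fix i :: 'd and a :: "'d list \<Rightarrow> real" assume "\<exists>n. \<forall>w. n \<le> length w \<longrightarrow> a w = 0"
  then obtain n where "\<forall>w. n \<le> length w \<longrightarrow> a w = 0" ..
  then show "\<exists>n. \<forall>w. n \<le> length w \<longrightarrow> a (i # w) = 0" by (intro exI[of _ n]) simp
qed

text \<open>The list holds the letters in reverse order, so the letter appended last is its head, as in
\<open>iter_integral\<close>.\<close>

lift_definition append_letter :: "'d \<Rightarrow> 'd shuffle \<Rightarrow> 'd shuffle"
  is "\<lambda>i a w. case w of [] \<Rightarrow> 0 | j # u \<Rightarrow> if i = j then a u else 0"
proof -
  fix i :: 'd and a :: "'d list \<Rightarrow> real" assume "\<exists>n. \<forall>w. n \<le> length w \<longrightarrow> a w = 0"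
  then obtain n where "\<forall>w. n \<le> length w \<longrightarrow> a w = 0" ..
  then show "\<exists>n. \<forall>w. n \<le> length w \<longrightarrow> (case w of [] \<Rightarrow> 0 | j # u \<Rightarrow> if i = j then a u else 0) = 0"
    by (intro exI[of _ "Suc n"]) (auto split: list.split)
qed

lift_definition word :: "'d list \<Rightarrow> 'd shuffle" is "\<lambda>v w. if w = v then 1 else 0"
  by (rule_tac x = "Suc (length list)" in exI) auto

lemma coef_letter_deriv [simp]: "coef (letter_deriv i a) u = coef a (i # u)"
  by transfer simp

lemma coef_append_letter_Nil [simp]: "coef (append_letter i a) [] = 0"
  by transfer simp

lemma coef_word: "coef (word v) w = (if w = v then 1 else 0)"
  by transfer simp

lemma letter_deriv_append_letter: "letter_deriv j (append_letter i a) = (if i = j then a else 0)"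
  by (rule shuffle_eqI) (transfer, simp)

definition derivation :: "('d shuffle \<Rightarrow> 'd shuffle) \<Rightarrow> bool" where
  "derivation T \<longleftrightarrow> linear T \<and> (\<forall>a b. T (a * b) = T a * b + a * T b)"

lemma derivation_mult: "derivation T \<Longrightarrow> T (a * b) = T a * b + a * T b"
  by (simp add: derivation_def)

lemma derivation_linear: "derivation T \<Longrightarrow> linear T"
  by (simp add: derivation_def)

lemma derivation_one: "derivation T \<Longrightarrow> T 1 = 0"
  using derivation_mult[of T 1 1] by simp

lemma derivation_power: "derivation T \<Longrightarrow> T (a ^ n) = of_nat n * a ^ (n - 1) * T a"
proof (induction n)
  case (Suc n)
  then show ?case by (cases n) (simp_all add: derivation_mult algebra_simps derivation_one)
qed (simp add: derivation_one)

lemma derivation_letter_deriv: "derivation (letter_deriv i)"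
  unfolding derivation_def
proof (intro conjI allI)
  show "linear (letter_deriv i)" by (rule linearI) (simp_all add: shuffle_eqI)
  show "letter_deriv i (a * b) = letter_deriv i a * b + a * letter_deriv i b" for a b
    by (rule shuffle_eqI) (transfer, simp)
qed

lemma derivation_zero: "derivation (\<lambda>a. 0)"
  by (simp add: derivation_def linear_zero)

lemma derivation_add: "\<lbrakk>derivation S; derivation T\<rbrakk> \<Longrightarrow> derivation (\<lambda>a. S a + T a)"
  by (simp add: derivation_def linear_compose_add algebra_simps)

lemma derivation_scale: "derivation T \<Longrightarrow> derivation (\<lambda>a. c *\<^sub>R T a)"
  by (simp add: derivation_def linear_compose_scale_right algebra_simps)

lemma derivation_sum: "(\<And>i. i \<in> I \<Longrightarrow> derivation (T i)) \<Longrightarrow> derivation (\<lambda>a. \<Sum>i\<in>I. T i a)"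
  by (induction I rule: infinite_finite_induct) (simp_all add: derivation_zero derivation_add)

lemma derivation_commutator:
  assumes "derivation S" "derivation T"
  shows "derivation (\<lambda>a. S (T a) - T (S a))"
  unfolding derivation_def
proof (intro conjI allI)
  note l = assms[THEN derivation_linear]
  show "linear (\<lambda>a. S (T a) - T (S a))"
    using linear_compose_sub[OF linear_compose[OF l(2,1)] linear_compose[OF l]] by (simp add: o_def)
  show "S (T (a * b)) - T (S (a * b)) = (S (T a) - T (S a)) * b + a * (S (T b) - T (S b))" for a b
    by (simp add: assms derivation_mult linear_add[OF l(1)] linear_add[OF l(2)] algebra_simps)
qed

text \<open>Each derivative costs at most one factor \<open>p\<close>.\<close>

lemma letter_deriv_power_mult: "\<exists>q'. letter_deriv i (p ^ Suc n * q) = p ^ n * q'"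
proof -
  have "letter_deriv i (p ^ Suc n * q)
      = p ^ n * (of_nat (Suc n) * letter_deriv i p * q + p * letter_deriv i q)"
    by (simp only: derivation_mult[OF derivation_letter_deriv] derivation_power[OF derivation_letter_deriv])
      (simp add: algebra_simps)
  then show ?thesis by blast
qed

section \<open>Pairing with tensor series\<close>

definition words_below :: "nat \<Rightarrow> 'd list set" where
  "words_below n = {w. length w < n}"

lemma finite_words_below [simp]: "finite (words_below n :: 'd::finite list set)"
proof -
  have "words_below n \<subseteq> {w :: 'd list. set w \<subseteq> UNIV \<and> length w \<le> n}" by (auto simp: words_below_def)
  then show ?thesis by (rule finite_subset) (rule finite_lists_length_le, simp)
qed

lemma sum_words_below_Suc:
  fixes f :: "'d::finite list \<Rightarrow> 'b::comm_monoid_add"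
  shows "(\<Sum>w\<in>words_below (Suc n). f w) = f [] + (\<Sum>i\<in>UNIV. \<Sum>w\<in>words_below n. f (i # w))"
proof -
  have eq: "words_below (Suc n) = insert [] ((\<lambda>(i, w). i # w) ` (UNIV \<times> words_below n) :: 'd list set)"
  proof (rule set_eqI)
    fix w :: "'d list"
    show "w \<in> words_below (Suc n) \<longleftrightarrow> w \<in> insert [] ((\<lambda>(i, w). i # w) ` (UNIV \<times> words_below n))"
      by (cases w) (auto simp: words_below_def image_iff)
  qed
  have "(\<Sum>w\<in>words_below (Suc n). f w) = f [] + (\<Sum>w\<in>(\<lambda>(i, w). i # w) ` (UNIV \<times> words_below n). f w)"
    unfolding eq by (subst sum.insert) auto
  also have "(\<Sum>w\<in>(\<lambda>(i, w). i # w) ` (UNIV \<times> words_below n). f w) = (\<Sum>(i, w)\<in>UNIV \<times> words_below n. f (i # w))"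
    by (subst sum.reindex) (auto simp: inj_on_def split_def)
  finally show ?thesis by (simp add: sum.cartesian_product)
qed

definition pairing :: "'d::finite shuffle \<Rightarrow> 'd tensor_series \<Rightarrow> real" where
  "pairing a Z = (\<Sum>w | coef a w \<noteq> 0. coef a w * Z w)"

lemma coef_bound: obtains n where "\<And>w. n \<le> length w \<Longrightarrow> coef a w = 0"
  using coef[of a] by blast

lemma pairing_words_below:
  assumes "\<And>w. n \<le> length w \<Longrightarrow> coef a w = 0"
  shows "pairing a Z = (\<Sum>w\<in>words_below n. coef a w * Z w)"
proof -
  have "{w. coef a w \<noteq> 0} \<subseteq> words_below n"
  proof
    fix w assume "w \<in> {w. coef a w \<noteq> 0}"
    then have "\<not> n \<le> length w" using assms by blast
    then show "w \<in> words_below n" by (simp add: words_below_def)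
  qed
  then show ?thesis unfolding pairing_def by (intro sum.mono_neutral_left) auto
qed

lemma pairing_add: "pairing (a + b) Z = pairing a Z + pairing b Z"
proof -
  obtain m where m: "\<And>w. m \<le> length w \<Longrightarrow> coef a w = 0" using coef_bound[of a] by blast
  obtain n where n: "\<And>w. n \<le> length w \<Longrightarrow> coef b w = 0" using coef_bound[of b] by blast
  show ?thesis
    using pairing_words_below[of "max m n" a Z] pairing_words_below[of "max m n" b Z]
      pairing_words_below[of "max m n" "a + b" Z] m n
    by (simp add: sum.distrib distrib_right)
qed

lemma pairing_scale: "pairing (c *\<^sub>R a) Z = c * pairing a Z"
proof -
  obtain m where m: "\<And>w. m \<le> length w \<Longrightarrow> coef a w = 0" using coef_bound[of a] by blast
  show ?thesis
    using pairing_words_below[of m a Z] pairing_words_below[of m "c *\<^sub>R a" Z] m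
    by (simp add: sum_distrib_left mult.assoc)
qed

lemma linear_pairing: "linear (\<lambda>a. pairing a Z)"
  by (rule linearI) (simp_all add: pairing_add pairing_scale)

lemma pairing_zero [simp]: "pairing 0 Z = 0" by (simp add: pairing_def)

lemma pairing_diff: "pairing (a - b) Z = pairing a Z - pairing b Z"
  using linear_diff[OF linear_pairing] .

lemma pairing_sum: "pairing (\<Sum>i\<in>I. f i) Z = (\<Sum>i\<in>I. pairing (f i) Z)"
  using linear_sum[OF linear_pairing] .

lemma pairing_word [simp]: "pairing (word w) Z = Z w"
  by (simp add: pairing_def coef_word)

lemma one_eq_word: "1 = word []"
  by (rule shuffle_eqI) (simp add: coef_word tone_def)

lemma pairing_one [simp]: "pairing 1 Z = Z []"
  by (simp add: one_eq_word)

lemma pairing_tone [simp]: "pairing a tone = coef a []"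
proof -
  obtain m where m: "\<And>w. m \<le> length w \<Longrightarrow> coef a w = 0" using coef_bound[of a] by blast
  then have "pairing a tone = (\<Sum>w\<in>words_below (Suc m). coef a w * tone w)" by (intro pairing_words_below) simp
  also have "\<dots> = (\<Sum>w\<in>words_below (Suc m). if w = [] then coef a w else 0)"
    by (intro sum.cong) (auto simp: tone_def)
  also have "\<dots> = coef a []"
  proof -
    have "([] :: 'a list) \<in> words_below (Suc m)" by (simp add: words_below_def)
    then show ?thesis by simp
  qed
  finally show ?thesis .
qed

lemma pairing_series_add: "pairing a (\<lambda>w. Y w + Z w) = pairing a Y + pairing a Z"
  by (simp add: pairing_def sum.distrib distrib_left)

lemma pairing_series_scale: "pairing a (\<lambda>w. c * Z w) = c * pairing a Z"
  by (simp add: pairing_def sum_distrib_left mult.left_commute)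

lemma pairing_Cons:
  "pairing a Z = coef a [] * Z [] + (\<Sum>i\<in>UNIV. pairing (letter_deriv i a) (\<lambda>u. Z (i # u)))"
proof -
  obtain m where m: "\<And>w. m \<le> length w \<Longrightarrow> coef a w = 0" using coef_bound[of a] by blast
  have "pairing a Z = (\<Sum>w\<in>words_below (Suc m). coef a w * Z w)" using m by (intro pairing_words_below) simp
  moreover have "pairing (letter_deriv i a) (\<lambda>u. Z (i # u)) = (\<Sum>w\<in>words_below m. coef a (i # w) * Z (i # w))" for i
    by (subst pairing_words_below[where n = m]) (use m in auto)
  ultimately show ?thesis by (simp add: sum_words_below_Suc)
qed

lemma pairing_separates:
  assumes "\<And>Z. pairing a Z = pairing b Z"
  shows "a = b"
proof (rule shuffle_eqI)
  fix w
  have "pairing c (\<lambda>u. if u = w then 1 else 0) = coef c w" for c :: "'a shuffle"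
  proof -
    obtain m where m: "\<And>w. m \<le> length w \<Longrightarrow> coef c w = 0" using coef_bound[of c] by blast
    have "pairing c (\<lambda>u. if u = w then 1 else 0)
        = (\<Sum>u\<in>words_below (max m (Suc (length w))). coef c u * (if u = w then 1 else 0))"
      by (rule pairing_words_below) (use m in auto)
    also have "\<dots> = (\<Sum>u\<in>words_below (max m (Suc (length w))). if u = w then coef c u else 0)"
      by (rule sum.cong) auto
    also have "\<dots> = coef c w"
    proof -
      have "w \<in> words_below (max m (Suc (length w)))" by (simp add: words_below_def)
      then show ?thesis by simp
    qed
    finally show ?thesis .
  qed
  from this[of a] this[of b] show "coef a w = coef b w" using assms by simp
qed

section \<open>The derivation attached to a Lie polynomial\<close>

primrec word_deriv :: "'d list \<Rightarrow> 'd shuffle \<Rightarrow> 'd shuffle" where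
  "word_deriv [] a = a"
| "word_deriv (i # w) a = word_deriv w (letter_deriv i a)"

lemma linear_word_deriv: "linear (word_deriv w)"
proof (induction w)
  case (Cons i w)
  then show ?case
    using linear_compose[OF derivation_linear[OF derivation_letter_deriv] Cons] by (simp add: o_def)
qed (simp add: linear_ident)

lemma word_deriv_0: "word_deriv w 0 = 0"
  using linear_0[OF linear_word_deriv] .

lemma word_deriv_power_mult: "length w \<le> n \<Longrightarrow> \<exists>q'. word_deriv w (p ^ n * q) = p ^ (n - length w) * q'"
proof (induction w arbitrary: n q)
  case (Cons i w)
  then obtain m where m: "n = Suc m" "length w \<le> m" by (cases n) auto
  obtain q' where "letter_deriv i (p ^ Suc m * q) = p ^ m * q'" using letter_deriv_power_mult by metis
  then show ?case using Cons.IH[OF m(2), of q'] m(1) by simp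
qed auto

text \<open>The operator \<open>D\<^sub>P\<close> for a series \<open>P\<close> that vanishes on words of length at least \<open>N\<close>: the derivative along
the curve \<open>s \<mapsto> exp (s P)\<close>.\<close>

definition deriv_along :: "nat \<Rightarrow> 'd::finite tensor_series \<Rightarrow> 'd shuffle \<Rightarrow> 'd shuffle" where
  "deriv_along N P a = (\<Sum>w\<in>words_below N. P w *\<^sub>R word_deriv w a)"

lemma linear_deriv_along: "linear (deriv_along N P)"
proof -
  have "linear (\<lambda>a. \<Sum>w\<in>words_below N. P w *\<^sub>R word_deriv w a)"
    by (intro linear_compose_sum linear_compose_scale_right ballI linear_word_deriv)
  then show ?thesis by (simp add: deriv_along_def[abs_def])
qed

text \<open>So \<open>D\<^sub>P\<close> is adjoint to multiplication by \<open>P\<close>. This turns products and powers of tensor series into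
compositions of operators.\<close>

lemma pairing_deriv_along:
  assumes "\<And>w. N \<le> length w \<Longrightarrow> P w = 0"
  shows "pairing (deriv_along N P a) Z = pairing a (tprod P Z)"
  using assms
proof (induction N arbitrary: P a)
  case 0
  then have "tprod P Z = (\<lambda>w. 0)" by (simp add: tprod_def fun_eq_iff)
  then show ?case by (simp add: deriv_along_def words_below_def pairing_def)
next
  case (Suc N)
  have IH: "pairing (deriv_along N (\<lambda>u. P (i # u)) b) Z = pairing b (tprod (\<lambda>u. P (i # u)) Z)" for i b
    by (rule Suc.IH) (use Suc.prems in simp)
  have "deriv_along (Suc N) P a
      = P [] *\<^sub>R a + (\<Sum>i\<in>UNIV. deriv_along N (\<lambda>u. P (i # u)) (letter_deriv i a))"
    by (simp add: deriv_along_def sum_words_below_Suc)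
  then have "pairing (deriv_along (Suc N) P a) Z
      = P [] * pairing a Z + (\<Sum>i\<in>UNIV. pairing (letter_deriv i a) (tprod (\<lambda>u. P (i # u)) Z))"
    by (simp add: pairing_add pairing_scale pairing_sum IH)
  moreover have "pairing a (tprod P Z) = coef a [] * (P [] * Z [])
      + (\<Sum>i\<in>UNIV. pairing (letter_deriv i a) (\<lambda>u. P [] * Z (i # u) + tprod (\<lambda>u. P (i # u)) Z u))"
    by (subst pairing_Cons) (simp add: tprod_Nil tprod_Cons)
  ultimately show ?case
    by (simp add: pairing_series_add pairing_series_scale sum.distrib pairing_Cons[of a Z]
        sum_distrib_left algebra_simps)
qed

lemma deriv_along_tprod:
  assumes "\<And>w. N \<le> length w \<Longrightarrow> A w = 0" "\<And>w. N \<le> length w \<Longrightarrow> B w = 0"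
    "\<And>w. N \<le> length w \<Longrightarrow> tprod A B w = 0"
  shows "deriv_along N (tprod A B) a = deriv_along N B (deriv_along N A a)"
  by (rule pairing_separates) (simp add: assms pairing_deriv_along tprod_assoc)

lemma deriv_along_diff: "deriv_along N (tminus A B) a = deriv_along N A a - deriv_along N B a"
  by (simp add: deriv_along_def tminus_def scaleR_left_diff_distrib sum_subtractf)

lemma deriv_along_scale: "deriv_along N (\<lambda>w. c * A w) a = c *\<^sub>R deriv_along N A a"
  by (simp add: deriv_along_def scaleR_sum_right)

lemma deriv_along_sum: "deriv_along N (\<lambda>w. \<Sum>j\<in>J. A j w) a = (\<Sum>j\<in>J. deriv_along N (A j) a)"
  unfolding deriv_along_def scaleR_sum_left by (rule sum.swap)

text \<open>For a vector \<open>v\<close>, the operator is the linear combination \<open>\<Sum>\<^sub>i v\<^sub>i D\<^sub>i\<close> of letter derivatives.\<close>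

lemma derivation_deriv_along_tvec:
  assumes "2 \<le> N"
  shows "derivation (deriv_along N (\<lambda>w. tvec v (rev w)))"
proof -
  obtain M where N: "N = Suc (Suc M)" using assms by (metis Suc_le_D numeral_2_eq_2 Suc_le_mono)
  have "deriv_along N (\<lambda>w. tvec v (rev w)) = (\<lambda>a. \<Sum>i\<in>UNIV. (v $ i) *\<^sub>R letter_deriv i a)"
    unfolding deriv_along_def N sum_words_below_Suc by (simp add: tvec_def)
  then show ?thesis by (simp add: derivation_sum derivation_scale derivation_letter_deriv)
qed

lemma tprod_homogeneous:
  assumes "\<And>w. length w \<noteq> j \<Longrightarrow> A w = 0" "\<And>w. length w \<noteq> k \<Longrightarrow> B w = 0" "length w \<noteq> j + k"
  shows "tprod A B w = 0"
  unfolding tprod_def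
proof (rule sum.neutral, rule ballI)
  fix n assume "n \<in> {..length w}"
  then show "A (take n w) * B (drop n w) = 0"
    using assms by (cases "n = j") auto
qed

lemma iter_bracket_support: "length w \<noteq> length V \<Longrightarrow> iter_bracket V w = 0"
proof (induction V arbitrary: w rule: iter_bracket.induct)
  case (3 v u vs)
  have A: "tvec v x = 0" if "length x \<noteq> 1" for x using that by (simp add: tvec_def)
  note B = "3.IH"
  have "tprod (tvec v) (iter_bracket (u # vs)) w = 0"
    by (rule tprod_homogeneous[OF A B]) (use "3.prems" in auto)
  moreover have "tprod (iter_bracket (u # vs)) (tvec v) w = 0"
    by (rule tprod_homogeneous[OF B A]) (use "3.prems" in auto)
  ultimately show ?case by (simp add: bracket_def tminus_def)
qed (simp_all add: tzero_def tvec_def)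

text \<open>A bracket of tensor series acts as a commutator of operators, and commutators of derivations are derivations.\<close>

lemma derivation_deriv_along_iter_bracket:
  assumes "length V < N"
  shows "derivation (deriv_along N (\<lambda>w. iter_bracket V (rev w)))"
  using assms
proof (induction V rule: iter_bracket.induct)
  case 1
  have "deriv_along N (\<lambda>w. iter_bracket ([] :: (real ^ 'a) list) (rev w)) = (\<lambda>a. 0)"
    by (simp add: deriv_along_def tzero_def fun_eq_iff)
  then show ?case by (simp only: derivation_zero)
next
  case (2 v)
  then show ?case using derivation_deriv_along_tvec[of N v] by simp
next
  case (3 v u vs)
  define A where "A = (\<lambda>w. tvec v (rev w))"
  define B where "B = (\<lambda>w. iter_bracket (u # vs) (rev w))"
  have A: "A w = 0" if "length w \<noteq> 1" for w using that by (simp add: A_def tvec_def)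
  have B: "B w = 0" if "length w \<noteq> Suc (length vs)" for w
    using that by (simp add: B_def iter_bracket_support)
  have N: "Suc (Suc (length vs)) < N" using "3.prems" by simp
  have AB: "tprod A B w = 0" if "N \<le> length w" for w
    by (rule tprod_homogeneous[OF A B]) (use that N in auto)
  have BA: "tprod B A w = 0" if "N \<le> length w" for w
    by (rule tprod_homogeneous[OF B A]) (use that N in auto)
  have "(\<lambda>w. iter_bracket (v # u # vs) (rev w)) = tminus (tprod B A) (tprod A B)"
    by (simp add: bracket_def tminus_def A_def B_def tprod_rev)
  then have "deriv_along N (\<lambda>w. iter_bracket (v # u # vs) (rev w))
      = (\<lambda>a. deriv_along N A (deriv_along N B a) - deriv_along N B (deriv_along N A a))"
    using A B AB BA N by (simp add: fun_eq_iff deriv_along_diff deriv_along_tprod)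
  moreover have "derivation (deriv_along N A)"
    unfolding A_def using N by (intro derivation_deriv_along_tvec) simp
  moreover have "derivation (deriv_along N B)"
    unfolding B_def using "3.IH" N by simp
  ultimately show ?case by (simp add: derivation_commutator)
qed

text \<open>A Lie polynomial is a finite linear combination of iterated brackets. Its words are reversed here to match
the order of letters in \<open>iter_integral\<close>.\<close>

lemma lie_polynomial_derivation:
  assumes "lie_polynomial P"
  obtains N where "\<And>w. N \<le> length w \<Longrightarrow> P w = 0"
    and "derivation (deriv_along N (\<lambda>w. P (rev w)))"
proof -
  have fin: "finite {k. tproj k P \<noteq> tzero}" and lie: "lie_series P"
    using assms by (auto simp: lie_polynomial_def)
  obtain N where N: "\<And>k. tproj k P \<noteq> tzero \<Longrightarrow> k < N"
    using fin by (metis (mono_tags, lifting) finite_nat_set_iff_bounded mem_Collect_eq)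
  have P0: "P w = 0" if "N \<le> length w" for w
  proof -
    have "tproj (length w) P = tzero" using N[of "length w"] that by auto
    then show ?thesis by (metis tproj_def tzero_def)
  qed
  have hom: "derivation (deriv_along N (\<lambda>w. tproj k P (rev w)))" if "k < N" for k
  proof (cases k)
    case 0
    then have "deriv_along N (\<lambda>w. tproj k P (rev w)) = (\<lambda>a. 0)"
      using lie by (simp add: lie_series_def tzero_def deriv_along_def fun_eq_iff)
    then show ?thesis by (simp add: derivation_zero)
  next
    case (Suc k')
    then have "lie_homogeneous k (tproj k P)" using lie by (simp add: lie_series_def)
    then obtain M c V where V: "\<forall>j<M. length (V j) = k"
      and eq: "tproj k P = (\<lambda>w. \<Sum>j<M::nat. c j * iter_bracket (V j) w)"
      unfolding lie_homogeneous_def by blast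
    have "deriv_along N (\<lambda>w. tproj k P (rev w))
        = (\<lambda>a. \<Sum>j<M. c j *\<^sub>R deriv_along N (\<lambda>w. iter_bracket (V j) (rev w)) a)"
      by (simp add: eq deriv_along_sum deriv_along_scale fun_eq_iff)
    moreover have "derivation (\<lambda>a. \<Sum>j<M. c j *\<^sub>R deriv_along N (\<lambda>w. iter_bracket (V j) (rev w)) a)"
      by (intro derivation_sum derivation_scale derivation_deriv_along_iter_bracket)
        (use V \<open>k < N\<close> in auto)
    ultimately show ?thesis by simp
  qed
  have "P (rev w) = (\<Sum>k<N. tproj k P (rev w))" for w
    using P0[of "rev w"] by (simp add: tproj_def not_less)
  then have eq: "(\<lambda>w. P (rev w)) = (\<lambda>w. \<Sum>k<N. tproj k P (rev w))" by blast
  have "deriv_along N (\<lambda>w. P (rev w)) = (\<lambda>a. \<Sum>k<N. deriv_along N (\<lambda>w. tproj k P (rev w)) a)"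
    by (rule ext, subst eq, rule deriv_along_sum)
  then have "derivation (deriv_along N (\<lambda>w. P (rev w)))"
    by (simp only:) (intro derivation_sum hom, simp)
  with P0 show thesis by (rule that)
qed

section \<open>Functions that vanish along the curve of a Lie polynomial\<close>

locale primitive =
  fixes N :: nat and P :: "'d::finite tensor_series"
  assumes bounded: "N \<le> length w \<Longrightarrow> P w = 0"
    and no_constant: "P [] = 0"
    and derivation: "derivation (deriv_along N P)"
begin

lemma pairing_tpow_Suc: "pairing a (tpow P (Suc k)) = pairing (deriv_along N P a) (tpow P k)"
  by (simp add: pairing_deriv_along bounded)

text \<open>The functions that vanish along \<open>s \<mapsto> exp (s P)\<close>: the pairing with \<open>P\<^sup>k\<close> is the \<open>k\<close>-th derivative at
\<open>s = 0\<close> of a function that is polynomial in \<open>s\<close>.\<close>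

definition curve_ideal :: "'d shuffle set" where
  "curve_ideal = {a. \<forall>k. pairing a (tpow P k) = 0}"

lemma curve_ideal_deriv_along: "a \<in> curve_ideal \<Longrightarrow> deriv_along N P a \<in> curve_ideal"
  unfolding curve_ideal_def mem_Collect_eq by (metis pairing_tpow_Suc)

text \<open>The Leibniz rule for the derivation \<open>D\<^sub>P\<close>, by induction on the order of the derivative.\<close>

lemma curve_ideal_mult:
  assumes "a \<in> curve_ideal"
  shows "a * b \<in> curve_ideal"
proof -
  have "pairing (a * b) (tpow P k) = 0" for k
    using assms
  proof (induction k arbitrary: a b)
    case 0
    then have "pairing a (tpow P 0) = 0" unfolding curve_ideal_def by blast
    then show ?case by simp
  next
    case (Suc k)
    show ?case
      using Suc.IH[OF Suc.prems] Suc.IH[OF curve_ideal_deriv_along[OF Suc.prems]]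
      unfolding pairing_tpow_Suc derivation_mult[OF derivation] by (simp add: pairing_add)
  qed
  then show ?thesis by (simp add: curve_ideal_def)
qed

lemma curve_ideal_sum_scale: "(\<And>i. i \<in> I \<Longrightarrow> a i \<in> curve_ideal) \<Longrightarrow> (\<Sum>i\<in>I. c i *\<^sub>R a i) \<in> curve_ideal"
  by (simp add: curve_ideal_def pairing_sum pairing_scale)

lemma zero_in_curve_ideal: "0 \<in> curve_ideal" by (simp add: curve_ideal_def)

text \<open>Every term of \<open>D\<^sub>P\<close> is a composition of fewer than \<open>N\<close> letter derivatives. The first of them only
removes the appended letter, and the others cannot use up all \<open>N\<close> factors \<open>p\<close>.\<close>

lemma append_letter_in_curve_ideal:
  assumes "p \<in> curve_ideal"
  shows "append_letter i (p ^ N * q) \<in> curve_ideal"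
proof -
  let ?e = "append_letter i (p ^ N * q)"
  have "P w *\<^sub>R word_deriv w ?e \<in> curve_ideal" if "w \<in> words_below N" for w
  proof (cases w)
    case Nil
    then show ?thesis by (simp add: no_constant zero_in_curve_ideal)
  next
    case (Cons j u)
    show ?thesis
    proof (cases "i = j")
      case True
      \<comment> \<open>the first letter of \<open>w\<close> is spent on the appended \<open>i\<close>; fewer than \<open>N\<close> derivatives are left\<close>
      have len: "length u < N" using that Cons by (simp add: words_below_def)
      then obtain q' where "word_deriv u (p ^ N * q) = p ^ (N - length u) * q'"
        using word_deriv_power_mult[of u N p q] by auto
      also have "\<dots> = p * (p ^ (N - Suc (length u)) * q')"
        using len by (metis Suc_diff_Suc mult.assoc power_Suc)
      finally have "word_deriv w ?e \<in> curve_ideal"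
        using curve_ideal_mult[OF assms] Cons True by (simp add: letter_deriv_append_letter)
      then show ?thesis using curve_ideal_sum_scale[of "{w}" "\<lambda>w. word_deriv w ?e" P] by simp
    qed (simp add: Cons letter_deriv_append_letter word_deriv_0 zero_in_curve_ideal)
  qed
  then have "deriv_along N P ?e \<in> curve_ideal"
    unfolding deriv_along_def
    using curve_ideal_sum_scale[of "words_below N" "\<lambda>w. P w *\<^sub>R word_deriv w ?e" "\<lambda>w. 1"] by simp
  then have "pairing ?e (tpow P (Suc k)) = 0" for k
    unfolding pairing_tpow_Suc by (simp add: curve_ideal_def)
  moreover have "pairing ?e (tpow P 0) = 0" by simp
  ultimately have "pairing ?e (tpow P k) = 0" for k by (cases k) blast+
  then show ?thesis by (simp add: curve_ideal_def)
qed

text \<open>A power series in \<open>P\<close> pairs with \<open>a\<close> through the powers of \<open>P\<close> only. For the exponential series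
this is the value of \<open>a\<close> at the end \<open>exp P\<close> of the curve.\<close>

lemma pairing_series_at_curve_ideal:
  assumes "a \<in> curve_ideal"
  shows "pairing a (series_at f P) = 0"
proof -
  obtain m where m: "\<And>w. m \<le> length w \<Longrightarrow> coef a w = 0" using coef_bound[of a] by blast
  have pw: "pairing a Z = (\<Sum>w\<in>words_below m. coef a w * Z w)" for Z
    by (rule pairing_words_below) (rule m)
  have "pairing a (series_at f P) = (\<Sum>w\<in>words_below m. coef a w * (\<Sum>n\<le>m. fps_nth f n * tpow P n w))"
    unfolding pw
  proof (rule sum.cong[OF refl])
    fix w :: "'d list" assume "w \<in> words_below m"
    then have "series_at f P w = (\<Sum>n\<le>m. fps_nth f n * tpow P n w)"
      by (intro series_at_upto no_constant) (simp add: words_below_def)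
    then show "coef a w * series_at f P w = coef a w * (\<Sum>n\<le>m. fps_nth f n * tpow P n w)" by simp
  qed
  also have "\<dots> = (\<Sum>n\<le>m. fps_nth f n * pairing a (tpow P n))"
    unfolding pw sum_distrib_left
    by (subst sum.swap) (simp add: mult.left_commute)
  also have "\<dots> = 0" using assms by (simp add: curve_ideal_def)
  finally show ?thesis .
qed

text \<open>Up to the factor \<open>P w0\<close>, the word \<open>w0\<close> has the derivative 1 along the curve
and thus measures the parameter \<open>s\<close>.\<close>

lemma time_coordinate:
  assumes "P \<noteq> tzero"
  obtains w0 where "P w0 \<noteq> 0" "deriv_along N P (word w0) = P w0 *\<^sub>R 1"
proof -
  obtain w where w: "P w \<noteq> 0" using assms by (auto simp: tzero_def)
  obtain w0 where w0: "P w0 \<noteq> 0" and min: "\<And>w. length w < length w0 \<Longrightarrow> P w = 0"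
    using ex_has_least_nat[of "\<lambda>w. P w \<noteq> 0" w length] w by (metis not_le)
  \<comment> \<open>\<open>P\<close> vanishes on all shorter words, so only the splitting of \<open>w0\<close> that takes off all of it
    contributes\<close>
  have "pairing (deriv_along N P (word w0)) Z = pairing (P w0 *\<^sub>R 1) Z" for Z
  proof -
    have "tprod P Z w0 = (\<Sum>n\<le>length w0. if n = length w0 then P w0 * Z [] else 0)"
      unfolding tprod_def by (intro sum.cong) (use min in auto)
    then show ?thesis by (simp add: pairing_deriv_along bounded pairing_scale)
  qed
  then have "deriv_along N P (word w0) = P w0 *\<^sub>R 1" by (rule pairing_separates)
  with w0 show thesis by (rule that)
qed

text \<open>Along the curve \<open>z\<close> equals \<open>s\<close>, so these are the derivatives of \<open>s\<^sup>k\<close> at \<open>s = 0\<close>.\<close>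

lemma power_pairing:
  assumes "deriv_along N P z = 1" "coef z [] = 0"
  shows "pairing (z ^ k) (tpow P m) = (if m = k then fact k else 0)"
proof (induction m arbitrary: k)
  case 0
  have "coef (z ^ k) [] = (if k = 0 then 1 else 0)"
    by (cases k) (simp_all add: assms(2) tone_def)
  then show ?case by simp
next
  case (Suc m)
  have *: "of_nat k * z ^ (k - 1) = real k *\<^sub>R z ^ (k - 1)"
    by (simp add: scaleR_conv_of_real)
  show ?case
    unfolding pairing_tpow_Suc derivation_power[OF derivation] assms(1) mult_1_right * pairing_scale Suc.IH
    by (cases k) auto
qed

text \<open>Along the curve, where \<open>z\<close> equals \<open>s\<close>, the word \<open>w\<close> has the value \<open>\<Sum>\<^sub>k P\<^sup>k w / k! \<cdot> s\<^sup>k\<close>.\<close>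

lemma word_minus_powers_in_curve_ideal:
  assumes "deriv_along N P z = 1" "coef z [] = 0"
  shows "word w - (\<Sum>k\<le>length w. (tpow P k w / fact k) *\<^sub>R z ^ k) \<in> curve_ideal"
proof -
  have "(\<Sum>k\<le>length w. tpow P k w / fact k * pairing (z ^ k) (tpow P m)) = tpow P m w" for m
  proof -
    have "(\<Sum>k\<le>length w. tpow P k w / fact k * pairing (z ^ k) (tpow P m))
        = (\<Sum>k\<le>length w. if k = m then tpow P m w else 0)"
      by (intro sum.cong) (auto simp: power_pairing[OF assms])
    also have "\<dots> = tpow P m w" using tpow_vanish[of P w m] no_constant by (simp add: not_le)
    finally show ?thesis .
  qed
  then show ?thesis by (simp add: curve_ideal_def pairing_diff pairing_sum pairing_scale)
qed

end

section \<open>Signatures of initial segments\<close>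

lemma reduced_pathD: "\<lbrakk>reduced_path \<gamma> a b; a \<le> c; c < d; d \<le> b\<rbrakk> \<Longrightarrow> signature \<gamma> c d \<noteq> tone"
  unfolding reduced_path_def by blast

locale controlled_path = control W for W +
  fixes \<gamma> :: "real \<Rightarrow> real ^ 'd::finite" and a b :: real
  assumes controlled: "controlled a b (\<lambda>t. \<gamma> t $ i)"
begin

lemma controlled_path_subinterval: "\<lbrakk>a \<le> c; d \<le> b\<rbrakk> \<Longrightarrow> controlled_path W \<gamma> c d"
  unfolding controlled_path_def controlled_path_axioms_def
  using control_axioms controlled_mono[OF controlled] by blast

text \<open>All iterated integrals exist, since each of them is again continuous and dominated by the control. They
satisfy \<open>dS = S \<otimes> d\<gamma>\<close> coefficient by coefficient.\<close>

lemma iter_integral_exists: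
  assumes "a \<le> b"
  shows "controlled a b (iter_integral \<gamma> a w)
     \<and> (\<forall>i. stieltjes a b (iter_integral \<gamma> a (i # w)) (iter_integral \<gamma> a w) (\<lambda>s. \<gamma> s $ i)
           \<and> iter_integral \<gamma> a (i # w) a = 0)"
proof -
  have step: "stieltjes a b (iter_integral \<gamma> a (i # w)) (iter_integral \<gamma> a w) (\<lambda>s. \<gamma> s $ i)
      \<and> iter_integral \<gamma> a (i # w) a = 0"
    if w: "controlled a b (iter_integral \<gamma> a w)" for i w
  proof -
    obtain F where F: "stieltjes a b F (iter_integral \<gamma> a w) (\<lambda>s. \<gamma> s $ i)" "F a = 0"
      using stieltjes_exists[OF controlled_continuous[OF w] controlled assms] by blast
    then have eq: "iter_integral \<gamma> a (i # w) t = F t" if "t \<in> {a..b}" for t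
      using stieltjes_rs_integral[OF F(1), of t] that by simp
    show ?thesis using stieltjes_cong[OF F(1) eq] eq[of a] F(2) assms by simp
  qed
  moreover have "controlled a b (iter_integral \<gamma> a w)"
  proof (induction w)
    case (Cons i w)
    then show ?case
      using step stieltjes_controlled[OF _ controlled_continuous controlled assms] by blast
  qed (simp add: controlled_const)
  ultimately show ?thesis by blast
qed

lemma controlled_iter_integral: "a \<le> b \<Longrightarrow> controlled a b (iter_integral \<gamma> a w)"
  using iter_integral_exists by blast

lemma stieltjes_iter_integral:
  "a \<le> b \<Longrightarrow> stieltjes a b (iter_integral \<gamma> a (i # w)) (iter_integral \<gamma> a w) (\<lambda>s. \<gamma> s $ i)"
  using iter_integral_exists by blast

lemma iter_integral_start: "a \<le> b \<Longrightarrow> iter_integral \<gamma> a w a = tone w"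
  using iter_integral_exists by (cases w) (auto simp: tone_def)

text \<open>The signature on \<open>[a, t]\<close>, with reversed words.\<close>

definition sig_upto :: "real \<Rightarrow> 'd tensor_series" where
  "sig_upto t = (\<lambda>w. iter_integral \<gamma> a w t)"

lemma sig_upto_start: "a \<le> b \<Longrightarrow> sig_upto a = tone"
  by (simp add: sig_upto_def iter_integral_start)

lemma sig_upto_Nil [simp]: "sig_upto t [] = 1" by (simp add: sig_upto_def)

lemma sig_upto_letter: "\<lbrakk>a \<le> b; t \<in> {a..b}\<rbrakk> \<Longrightarrow> sig_upto t [i] = \<gamma> t $ i - \<gamma> a $ i"
proof -
  assume ab: "a \<le> b" and t: "t \<in> {a..b}"
  have 1: "stieltjes a b (iter_integral \<gamma> a [i]) (\<lambda>x. 1) (\<lambda>s. \<gamma> s $ i)"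
    using stieltjes_iter_integral[OF ab, of i "[]"] by simp
  have 2: "stieltjes a b (\<lambda>s. \<gamma> s $ i) (\<lambda>x. 1) (\<lambda>s. \<gamma> s $ i)"
    unfolding stieltjes_def by (rule negligible_cong[OF negligible_zero]) simp
  have "iter_integral \<gamma> a [i] a = 0"
    by (simp only: iter_integral_start[OF ab]) (simp add: tone_def)
  then show ?thesis
    using stieltjes_unique[OF 1 2, of t] t unfolding sig_upto_def by simp
qed

lemma controlled_pairing:
  assumes "a \<le> b"
  shows "controlled a b (\<lambda>t. pairing q (sig_upto t))"
  unfolding pairing_def sig_upto_def
  by (intro controlled_sum controlled_cmult controlled_iter_integral assms)

lemma differential_pairing:
  assumes "a \<le> b"
  shows "negligible a b (\<lambda>s x t. pairing q (sig_upto t) - pairing q (sig_upto s)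
    - (\<Sum>i\<in>UNIV. pairing (letter_deriv i q) (sig_upto x) * (\<gamma> t $ i - \<gamma> s $ i)))"
proof -
  obtain m where m: "\<And>w. m \<le> length w \<Longrightarrow> coef q w = 0" using coef_bound[of q] by blast
  have 1: "pairing q Z = coef q [] * Z [] + (\<Sum>i\<in>UNIV. \<Sum>w\<in>words_below m. coef q (i # w) * Z (i # w))" for Z
  proof -
    have "pairing q Z = (\<Sum>w\<in>words_below (Suc m). coef q w * Z w)" using m by (intro pairing_words_below) simp
    then show ?thesis by (simp add: sum_words_below_Suc)
  qed
  have 2: "pairing (letter_deriv i q) Z = (\<Sum>w\<in>words_below m. coef q (i # w) * Z w)" for i Z
    by (subst pairing_words_below[where n = m]) (use m in auto)
  have "negligible a b (\<lambda>s x t. \<Sum>i\<in>UNIV. \<Sum>w\<in>words_below m. coef q (i # w) *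
      (sig_upto t (i # w) - sig_upto s (i # w) - sig_upto x w * (\<gamma> t $ i - \<gamma> s $ i)))"
    using stieltjes_iter_integral[OF assms] unfolding stieltjes_def sig_upto_def
    by (intro negligible_sum negligible_cmult)
  then show ?thesis
    by (rule negligible_cong)
      (simp add: 1 2 sum_distrib_right sum_subtractf[symmetric] right_diff_distrib mult.assoc)
qed

text \<open>In integrated form: appending \<open>i\<close> to the words of \<open>q\<close> gives the integral of \<open>q\<close> against \<open>d\<gamma>\<^sub>i\<close>.\<close>

lemma stieltjes_append_letter:
  assumes "a \<le> b"
  shows "stieltjes a b (\<lambda>t. pairing (append_letter i q) (sig_upto t)) (\<lambda>t. pairing q (sig_upto t)) (\<lambda>s. \<gamma> s $ i)"
proof -
  have "(\<Sum>j\<in>UNIV. pairing (letter_deriv j (append_letter i q)) (sig_upto x) * (\<gamma> t $ j - \<gamma> s $ j))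
      = pairing q (sig_upto x) * (\<gamma> t $ i - \<gamma> s $ i)" for s x t
  proof -
    have "(\<Sum>j\<in>UNIV. pairing (letter_deriv j (append_letter i q)) (sig_upto x) * (\<gamma> t $ j - \<gamma> s $ j))
        = (\<Sum>j\<in>UNIV. if j = i then pairing q (sig_upto x) * (\<gamma> t $ i - \<gamma> s $ i) else 0)"
      by (intro sum.cong) (auto simp: letter_deriv_append_letter)
    then show ?thesis by simp
  qed
  with differential_pairing[OF assms, of "append_letter i q"] show ?thesis
    by (simp add: stieltjes_def)
qed

text \<open>Both sides have the same value at \<open>a\<close>. Their differentials are given by letter derivatives, which obey
the Leibniz rule and lower the degree, so the differentials agree by induction on the total degree.\<close>

lemma shuffle_identity:
  assumes "a \<le> b" "t \<in> {a..b}"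
  shows "pairing (p * q) (sig_upto t) = pairing p (sig_upto t) * pairing q (sig_upto t)"
proof -
  have main: "\<forall>t\<in>{a..b}. pairing (p * q) (sig_upto t) = pairing p (sig_upto t) * pairing q (sig_upto t)"
    if "m + n \<le> k" "\<And>w. m \<le> length w \<Longrightarrow> coef p w = 0" "\<And>w. n \<le> length w \<Longrightarrow> coef q w = 0"
    for k m n p q
    using that
  proof (induction k arbitrary: m n p q)
    case 0
    then have "p = 0" by (intro shuffle_eqI) simp
    then show ?case by simp
  next
    case (Suc k)
    show ?case
    proof (cases "m = 0 \<or> n = 0")
      case True
      then have "p = 0 \<or> q = 0" using Suc.prems by (auto intro: shuffle_eqI)
      then show ?thesis by auto
    next
      case False
      then obtain m' n' where mn: "m = Suc m'" "n = Suc n'" by (metis not0_implies_Suc)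
      have l: "pairing (letter_deriv i p * q) (sig_upto t) = pairing (letter_deriv i p) (sig_upto t) * pairing q (sig_upto t)"
        if "t \<in> {a..b}" for i t
        using Suc.IH[of m' n "letter_deriv i p" q] Suc.prems mn that by simp
      have r: "pairing (p * letter_deriv i q) (sig_upto t) = pairing p (sig_upto t) * pairing (letter_deriv i q) (sig_upto t)"
        if "t \<in> {a..b}" for i t
        using Suc.IH[of m n' p "letter_deriv i q"] Suc.prems mn that by simp
      \<comment> \<open>\<open>?d q\<close> is the error in the differential of \<open>q\<close> along the path; by the product rule, the
        increments of the difference of both sides are a combination of such errors\<close>
      let ?d = "\<lambda>q s x t. pairing q (sig_upto t) - pairing q (sig_upto s)
          - (\<Sum>i\<in>UNIV. pairing (letter_deriv i q) (sig_upto x) * (\<gamma> t $ i - \<gamma> s $ i))"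
      let ?p = "\<lambda>t. pairing p (sig_upto t)" and ?q = "\<lambda>t. pairing q (sig_upto t)"
      note c = controlled_pairing[OF assms(1)]
      obtain K where K: "\<And>x. x \<in> {a..b} \<Longrightarrow> \<bar>?p x\<bar> \<le> K"
        using continuous_bounded[OF controlled_continuous[OF c[of p]]] by metis
      obtain L where L: "\<And>x. x \<in> {a..b} \<Longrightarrow> \<bar>?q x\<bar> \<le> L"
        using continuous_bounded[OF controlled_continuous[OF c[of q]]] by metis
      have A: "negligible a b (\<lambda>s x t. ?p x * ?d q s x t)"
        by (rule negligible_mult[OF differential_pairing[OF assms(1)], where K = K]) (use K in auto)
      have B: "negligible a b (\<lambda>s x t. ?q x * ?d p s x t)"
        by (rule negligible_mult[OF differential_pairing[OF assms(1)], where K = L]) (use L in auto)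
      have D: "negligible a b (\<lambda>s x t. ?d (p * q) s x t
          - (?p t * ?q t - ?p s * ?q s - (?p x * (?q t - ?q s) + ?q x * (?p t - ?p s)))
          - (?p x * ?d q s x t + ?q x * ?d p s x t))"
        by (rule negligible_diff[OF negligible_diff[OF differential_pairing[OF assms(1)] product_rule[OF c c]]
              negligible_add[OF A B]])
      have "negligible a b (\<lambda>s x t. (pairing (p * q) (sig_upto t) - ?p t * ?q t)
          - (pairing (p * q) (sig_upto s) - ?p s * ?q s))"
        using D
      proof (rule negligible_cong)
        fix s x t assume "a \<le> s" "s \<le> x" "x \<le> t" "t \<le> b"
        then have x: "x \<in> {a..b}" by simp
        have "(\<Sum>i\<in>UNIV. pairing (letter_deriv i (p * q)) (sig_upto x) * (\<gamma> t $ i - \<gamma> s $ i))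
            = ?q x * (\<Sum>i\<in>UNIV. pairing (letter_deriv i p) (sig_upto x) * (\<gamma> t $ i - \<gamma> s $ i))
              + ?p x * (\<Sum>i\<in>UNIV. pairing (letter_deriv i q) (sig_upto x) * (\<gamma> t $ i - \<gamma> s $ i))"
          unfolding derivation_mult[OF derivation_letter_deriv] pairing_add l[OF x] r[OF x]
            sum_distrib_left sum.distrib[symmetric]
          by (simp add: algebra_simps)
        then show "(pairing (p * q) (sig_upto t) - ?p t * ?q t) - (pairing (p * q) (sig_upto s) - ?p s * ?q s)
            = ?d (p * q) s x t
              - (?p t * ?q t - ?p s * ?q s - (?p x * (?q t - ?q s) + ?q x * (?p t - ?p s)))
              - (?p x * ?d q s x t + ?q x * ?d p s x t)"
          by (simp add: algebra_simps)
      qed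
      then have "pairing (p * q) (sig_upto t) - ?p t * ?q t = pairing (p * q) (sig_upto a) - ?p a * ?q a"
        if "t \<in> {a..b}" for t
        using that by (intro constant_if_negligible) auto
      then show ?thesis by (simp add: sig_upto_start[OF assms(1)])
    qed
  qed
  obtain m where m: "\<And>w. m \<le> length w \<Longrightarrow> coef p w = 0" using coef_bound[of p] by blast
  obtain n where n: "\<And>w. n \<le> length w \<Longrightarrow> coef q w = 0" using coef_bound[of q] by blast
  show ?thesis using main[OF order.refl m n] assms(2) by blast
qed

text \<open>As functions of \<open>t\<close>, both sides satisfy the same differential equation and agree at \<open>t = c\<close>.\<close>

lemma chen_identity:
  assumes c: "a \<le> c" "c \<le> b" and t: "t \<in> {c..b}"
  shows "sig_upto t = tprod (\<lambda>w. iter_integral \<gamma> c w t) (sig_upto c)"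
proof -
  interpret sub: controlled_path W \<gamma> c b by (rule controlled_path_subinterval) (use c in auto)
  have "\<forall>t\<in>{c..b}. sig_upto t w = tprod (\<lambda>w. iter_integral \<gamma> c w t) (sig_upto c) w" for w
  proof (induction w)
    case Nil
    show ?case by (simp add: tprod_Nil)
  next
    case (Cons i w)
    let ?F = "\<lambda>t. tprod (\<lambda>u. iter_integral \<gamma> c (i # u) t) (sig_upto c) w"
    have "negligible c b (\<lambda>s x t. \<Sum>n\<le>length w. sig_upto c (drop n w) *
        (iter_integral \<gamma> c (i # take n w) t - iter_integral \<gamma> c (i # take n w) s
          - iter_integral \<gamma> c (take n w) x * (\<gamma> t $ i - \<gamma> s $ i)))"
      using sub.stieltjes_iter_integral[OF c(2)] unfolding stieltjes_def
      by (intro negligible_sum negligible_cmult)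
    then have "stieltjes c b ?F (\<lambda>x. tprod (\<lambda>w. iter_integral \<gamma> c w x) (sig_upto c) w) (\<lambda>s. \<gamma> s $ i)"
      unfolding stieltjes_def
      by (rule negligible_cong)
        (simp only: tprod_def sum_distrib_right sum_subtractf[symmetric],
          rule sum.cong[OF refl], simp only: algebra_simps)
    then have 1: "stieltjes c b ?F (\<lambda>x. sig_upto x w) (\<lambda>s. \<gamma> s $ i)"
      by (rule stieltjes_cong) (use Cons.IH in auto)
    have 2: "stieltjes c b (\<lambda>t. sig_upto t (i # w)) (\<lambda>x. sig_upto x w) (\<lambda>s. \<gamma> s $ i)"
      unfolding sig_upto_def by (rule stieltjes_subinterval[OF stieltjes_iter_integral]) (use c in auto)
    have "iter_integral \<gamma> c (i # u) c = 0" for u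
      by (simp only: sub.iter_integral_start[OF c(2)]) (simp add: tone_def)
    then have "?F c = 0" unfolding tprod_def by (simp del: iter_integral.simps)
    then have "?F t = sig_upto t (i # w) - sig_upto c (i # w)" if "t \<in> {c..b}" for t
      using stieltjes_unique[OF 1 2, of t] that by simp
    then show ?case by (simp add: tprod_Cons)
  qed
  then show ?thesis using t by blast
qed

lemma inj_on_sig_upto:
  assumes "reduced_path \<gamma> a b"
  shows "inj_on sig_upto {a..b}"
proof -
  have "sig_upto s \<noteq> sig_upto t" if st: "s \<in> {a..b}" "t \<in> {a..b}" "s < t" for s t
  proof
    assume eq: "sig_upto s = sig_upto t"
    have "sig_upto t = tprod (\<lambda>w. iter_integral \<gamma> s w t) (sig_upto s)"
      by (rule chen_identity) (use st in auto)
    then have "tprod (\<lambda>w. iter_integral \<gamma> s w t) (sig_upto s) = sig_upto s" using eq by metis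
    then have "(\<lambda>w. iter_integral \<gamma> s w t) = tone" by (intro tprod_right_cancel) simp_all
    then have "signature \<gamma> s t = tone" by (simp add: signature_def tone_def fun_eq_iff)
    then show False using assms st unfolding reduced_path_def by auto
  qed
  then show ?thesis by (intro linorder_inj_onI) (blast, rule linear)
qed

lemma signature_constant_path:
  assumes "a \<le> b" "\<And>t. t \<in> {a..b} \<Longrightarrow> \<gamma> t = \<gamma> a"
  shows "signature \<gamma> a b = tone"
proof -
  have "iter_integral \<gamma> a w b = tone w" for w
  proof (cases w)
    case (Cons i u)
    have "stieltjes a b (\<lambda>t. 0) (iter_integral \<gamma> a u) (\<lambda>s. \<gamma> s $ i)"
      unfolding stieltjes_def
    proof (rule negligible_cong[OF negligible_zero])
      fix s x t assume "a \<le> s" "s \<le> x" "x \<le> t" "t \<le> b"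
      then have "\<gamma> t = \<gamma> a" "\<gamma> s = \<gamma> a" using assms(2)[of t] assms(2)[of s] by simp_all
      then show "0 - 0 - iter_integral \<gamma> a u x * (\<gamma> t $ i - \<gamma> s $ i) = 0" by simp
    qed
    from stieltjes_unique[OF stieltjes_iter_integral[OF assms(1)] this assms(1) order.refl]
    show ?thesis using iter_integral_start[OF assms(1), of w] Cons by simp
  qed (simp add: tone_def)
  then show ?thesis by (simp add: signature_def tone_def fun_eq_iff)
qed

section \<open>A polynomial log-signature forces the path to be straight\<close>

text \<open>Points are separated because \<open>sig_upto\<close> is injective; closure under products is the shuffle identity.\<close>

lemma function_ring_pairing:
  assumes "a < b" "reduced_path \<gamma> a b"
  shows "function_ring_on (range (\<lambda>q t. pairing q (sig_upto (max a (min b t))))) {a..b}"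
proof
  \<comment> \<open>Outside of \<open>[a, b]\<close> the shuffle identity may fail, while a function ring consists of functions on
    the whole line; hence the clamped argument.\<close>
  let ?c = "\<lambda>t. max a (min b t)"
  let ?R = "range (\<lambda>q t. pairing q (sig_upto (?c t)))"
  have clamp: "?c t \<in> {a..b}" for t using assms(1) by auto
  show "compact {a..b}" by simp
  show "continuous_on {a..b} f" if fR: "f \<in> ?R" for f
  proof -
    obtain q where f: "f = (\<lambda>t. pairing q (sig_upto (?c t)))" using fR by blast
    have "continuous_on {a..b} (\<lambda>t. pairing q (sig_upto t))"
      by (intro controlled_continuous controlled_pairing) (use assms in simp)
    then show ?thesis unfolding f by (rule continuous_on_eq) auto
  qed
  show "(\<lambda>x. f x + g x) \<in> ?R" if fg: "f \<in> ?R" "g \<in> ?R" for f g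
  proof -
    obtain p q where "f = (\<lambda>t. pairing p (sig_upto (?c t)))" "g = (\<lambda>t. pairing q (sig_upto (?c t)))"
      using fg by blast
    then have "(\<lambda>x. f x + g x) = (\<lambda>t. pairing (p + q) (sig_upto (?c t)))" by (simp add: pairing_add)
    then show ?thesis by blast
  qed
  show "(\<lambda>x. f x * g x) \<in> ?R" if fg: "f \<in> ?R" "g \<in> ?R" for f g
  proof -
    obtain p q where "f = (\<lambda>t. pairing p (sig_upto (?c t)))" "g = (\<lambda>t. pairing q (sig_upto (?c t)))"
      using fg by blast
    then have "(\<lambda>x. f x * g x) = (\<lambda>t. pairing (p * q) (sig_upto (?c t)))"
      using shuffle_identity[OF _ clamp] assms(1) by simp
    then show ?thesis by blast
  qed
  show "(\<lambda>_. c) \<in> ?R" for c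
  proof -
    have "(\<lambda>_. c) = (\<lambda>t. pairing (c *\<^sub>R 1) (sig_upto (?c t)))" by (simp add: pairing_scale)
    then show ?thesis by blast
  qed
  show "\<exists>f\<in>?R. f s \<noteq> f t" if st: "s \<in> {a..b}" "t \<in> {a..b}" "s \<noteq> t" for s t
  proof -
    have "sig_upto s \<noteq> sig_upto t" using inj_on_sig_upto[OF assms(2)] st by (meson inj_onD)
    then obtain w where "sig_upto s w \<noteq> sig_upto t w" by auto
    moreover have "?c s = s" "?c t = t" using st by auto
    ultimately show ?thesis by (intro bexI[OF _ rangeI[of _ "word w"]]) simp
  qed
qed

text \<open>The assumption on \<open>p\<close> says that the integrals of \<open>p q d\<gamma>\<^sub>i\<close> along the path are 0 for all \<open>q\<close>.\<close>

lemma vanishing_on_path: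
  assumes "a < b" and red: "reduced_path \<gamma> a b"
    and int: "\<And>i q. pairing (append_letter i (p * q)) (sig_upto b) = 0"
    and t: "t \<in> {a..b}"
  shows "pairing p (sig_upto t) = 0"
proof (rule ccontr)
  assume nz: "pairing p (sig_upto t) \<noteq> 0"
  have le: "a \<le> b" using \<open>a < b\<close> by simp
  let ?h = "\<lambda>t. pairing p (sig_upto t)"
  have ch: "continuous_on {a..b} ?h" by (intro controlled_continuous controlled_pairing le)
  \<comment> \<open>the measures \<open>?h d\<gamma>\<^sub>i\<close> are zero, since their integrals against all \<open>q\<close> are\<close>
  have dG: "stieltjes a b (\<lambda>t. 0) ?h (\<lambda>s. \<gamma> s $ i)" for i
  proof -
    let ?G = "\<lambda>t. pairing (append_letter i p) (sig_upto t)"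
    have G: "stieltjes a b ?G ?h (\<lambda>s. \<gamma> s $ i)" by (rule stieltjes_append_letter[OF le])
    have G_const: "?G t = ?G a" if "t \<in> {a..b}" for t
    proof (rule constant_if_integrals_vanish[OF \<open>a < b\<close> _ function_ring_pairing[OF \<open>a < b\<close> red] _ that])
      show "controlled a b ?G" by (rule controlled_pairing[OF le])
      fix f assume "f \<in> range (\<lambda>q t. pairing q (sig_upto (max a (min b t))))"
      then obtain q where f: "f = (\<lambda>t. pairing q (sig_upto (max a (min b t))))" by blast
      have eq: "f x = pairing q (sig_upto x)" if "x \<in> {a..b}" for x
      proof -
        have "max a (min b x) = x" using that by auto
        then show ?thesis by (simp only: f)
      qed
      have "continuous_on {a..b} (\<lambda>t. pairing q (sig_upto t))"
        by (intro controlled_continuous controlled_pairing le)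
      then have cf: "continuous_on {a..b} f" by (rule continuous_on_eq) (simp add: eq)
      let ?F = "\<lambda>t. pairing (append_letter i (p * q)) (sig_upto t)"
      have "stieltjes a b ?F (\<lambda>x. f x * ?h x) (\<lambda>s. \<gamma> s $ i)"
        by (rule stieltjes_cong[OF stieltjes_append_letter[OF le, of i "p * q"]])
          (simp_all add: eq shuffle_identity[OF le])
      then have "stieltjes a b ?F f ?G" by (rule stieltjes_factor[OF _ G cf])
      moreover have "?F b = ?F a" using int[of i q] by (simp add: sig_upto_start[OF le])
      ultimately show "\<exists>F. stieltjes a b F f ?G \<and> F b = F a" by (intro exI[of _ ?F] conjI)
    qed
    have "?G a = 0" by (simp add: sig_upto_start[OF le])
    then have G0: "?G t = 0" if "t \<in> {a..b}" for t using G_const[OF that] by (simp only:)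
    show ?thesis by (rule stieltjes_cong[OF G]) (simp_all add: G0)
  qed
  obtain c d where cd: "a \<le> c" "c < d" "d \<le> b" and nz: "\<And>x. x \<in> {c..d} \<Longrightarrow> ?h x \<noteq> 0"
  proof -
    from nz have "0 < \<bar>?h t\<bar>" by simp
    from ch[unfolded continuous_on_iff, rule_format, OF t this]
    obtain e where e: "0 < e" "\<forall>x\<in>{a..b}. dist x t < e \<longrightarrow> dist (?h x) (?h t) < \<bar>?h t\<bar>"
      by blast
    define c where "c = max a (t - e / 2)"
    define d where "d = min b (t + e / 2)"
    have "c < d" using t e(1) \<open>a < b\<close> by (auto simp: c_def d_def)
    moreover have "?h x \<noteq> 0" if "x \<in> {c..d}" for x
    proof -
      have "x \<in> {a..b}" "dist x t < e" using that e(1) by (auto simp: c_def d_def dist_real_def)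
      then have "dist (?h x) (?h t) < \<bar>?h t\<bar>" using bspec[OF e(2)] by simp
      then show ?thesis by (auto simp: dist_real_def)
    qed
    ultimately show thesis by (intro that[of c d]) (auto simp: c_def d_def)
  qed
  \<comment> \<open>on an interval where \<open>?h\<close> has no zero, the measure \<open>d\<gamma>\<^sub>i\<close> itself is zero\<close>
  have const: "\<gamma> s $ i = \<gamma> c $ i" if s: "s \<in> {c..d}" for s i
  proof -
    have "continuous_on {c..d} (\<lambda>x. inverse (?h x))"
      using nz cd by (intro continuous_on_inverse continuous_on_subset[OF ch]) auto
    then obtain K where K: "\<And>x. x \<in> {c..d} \<Longrightarrow> \<bar>inverse (?h x)\<bar> \<le> K" by (rule continuous_bounded) blast
    have "stieltjes c d (\<lambda>t. 0) ?h (\<lambda>s. \<gamma> s $ i)" by (rule stieltjes_subinterval[OF dG]) (use cd in auto)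
    then have "negligible c d (\<lambda>s x t. - inverse (?h x) * (0 - 0 - ?h x * (\<gamma> t $ i - \<gamma> s $ i)))"
      unfolding stieltjes_def by (rule negligible_mult[where K = K]) (use K in auto)
    then have "negligible c d (\<lambda>s x t. \<gamma> t $ i - \<gamma> s $ i)"
      by (rule negligible_cong) (use nz in simp)
    then show ?thesis by (rule constant_if_negligible) (use s in auto)
  qed
  interpret sub: controlled_path W \<gamma> c d by (rule controlled_path_subinterval) (use cd in auto)
  have "signature \<gamma> c d = tone"
  proof (rule sub.signature_constant_path)
    show "c \<le> d" using cd by simp
    show "\<gamma> s = \<gamma> c" if "s \<in> {c..d}" for s unfolding vec_eq_iff using const[OF that] by blast
  qed
  then show False using reduced_pathD[OF red cd] by simp
qed

end

lemma strict_mono_if_injective: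
  fixes s :: "real \<Rightarrow> real"
  assumes "a < b" "continuous_on {a..b} s" "inj_on s {a..b}" "s a = 0" "s b = 1"
  shows "strict_mono_on {a..b} s" "bij_betw s {a..b} {0..1}"
proof -
  have pos: "0 < s x \<and> s x < 1" if "a < x" "x < b" for x
    using continuous_inj_imp_mono[OF that assms(2,3)] assms(4,5) by auto
  have pos': "0 < s x" if "a < x" "x \<le> b" for x
    using pos[of x] that assms(5) by (cases "x = b") auto
  show mono: "strict_mono_on {a..b} s"
  proof (rule strict_mono_onI)
    fix x y assume *: "x \<in> {a..b}" "y \<in> {a..b}" "x < y"
    show "s x < s y"
    proof (cases "x = a")
      case True
      then show ?thesis using pos'[of y] * assms(4) by simp
    next
      case False
      have "continuous_on {a..y} s" "inj_on s {a..y}"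
        using * by (auto intro: continuous_on_subset[OF assms(2)] inj_on_subset[OF assms(3)])
      from continuous_inj_imp_mono[OF _ \<open>x < y\<close> this] show ?thesis
        using pos'[of x] * False assms(4) by auto
    qed
  qed
  have "s ` {a..b} = {0..1}"
  proof
    show "s ` {a..b} \<subseteq> {0..1}"
    proof clarify
      fix x assume "x \<in> {a..b}"
      then show "s x \<in> {0..1}"
        using pos[of x] assms by (cases "x = a"; cases "x = b") auto
    qed
    show "{0..1} \<subseteq> s ` {a..b}"
    proof
      fix y :: real assume "y \<in> {0..1}"
      then show "y \<in> s ` {a..b}" using IVT'[of s a y b] assms by force
    qed
  qed
  then show "bij_betw s {a..b} {0..1}" using assms(3) by (simp add: bij_betw_def)
qed

context controlled_path
begin

lemma straight_if_polynomial:
  assumes "a < b" and red: "reduced_path \<gamma> a b"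
    and poly: "lie_polynomial (log_signature \<gamma> a b)"
  shows "\<exists>v u s. strict_mono_on {a..b} s \<and> bij_betw s {a..b} {0..1} \<and> (\<forall>t\<in>{a..b}. \<gamma> t = s t *\<^sub>R v + u)"
proof -
  have le: "a \<le> b" using \<open>a < b\<close> by simp
  define P where "P = tlog (sig_upto b)"
  have sig: "signature \<gamma> a b = (\<lambda>w. sig_upto b (rev w))" by (simp add: signature_def sig_upto_def)
  have P: "(\<lambda>w. log_signature \<gamma> a b (rev w)) = P"
    by (simp add: log_signature_def sig tlog_rev P_def)
  obtain N where N: "\<And>w. N \<le> length w \<Longrightarrow> log_signature \<gamma> a b w = 0"
    and der: "derivation (deriv_along N P)"
    using lie_polynomial_derivation[OF poly] unfolding P by metis
  have exp: "series_at (fps_exp 1) P = sig_upto b" unfolding P_def by (rule exp_tlog) simp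
  interpret primitive N P
  proof
    show "P w = 0" if "N \<le> length w" for w using N[of "rev w"] that unfolding P[symmetric] by simp
    show "P [] = 0" by (simp add: P_def tlog_def tminus_def tprod_Nil tone_def)
  qed (rule der)
  have "P \<noteq> tzero"
  proof
    assume P0: "P = tzero"
    have "sig_upto b w = tone w" for w
    proof (cases "w = []")
      case False
      have "tpow P n w = 0" if "0 < n" for n
        using that by (cases n) (simp_all add: P0 tzero_def tprod_def)
      then have "series_at (fps_exp 1) P w = (\<Sum>n\<le>length w. if n = 0 then tone w else 0)"
        unfolding series_at_def by (intro sum.cong) auto
      then show ?thesis using exp by simp
    qed (simp add: tone_def)
    then have "signature \<gamma> a b = tone" by (simp add: sig tone_def fun_eq_iff)
    then show False using reduced_pathD[OF red _ \<open>a < b\<close>] by simp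
  qed
  then obtain w0 where w0: "P w0 \<noteq> 0" "deriv_along N P (word w0) = P w0 *\<^sub>R 1"
    using time_coordinate by metis
  have "w0 \<noteq> []" using w0(1) no_constant by auto
  define z where "z = (1 / P w0) *\<^sub>R word w0"
  define s where "s t = pairing z (sig_upto t)" for t
  have z: "deriv_along N P z = 1" "coef z [] = 0"
    using w0 \<open>w0 \<noteq> []\<close> by (simp_all add: z_def linear_scale[OF linear_deriv_along] coef_word)
  have s_eq: "s t = sig_upto t w0 / P w0" for t by (simp add: s_def z_def pairing_scale)
  have power: "pairing (z ^ k) (sig_upto t) = s t ^ k" if "t \<in> {a..b}" for k t
    by (induction k) (simp_all add: shuffle_identity[OF le that] s_def)
  \<comment> \<open>the equations of the curve \<open>exp (s P)\<close>, with \<open>z\<close> in the role of \<open>s\<close>, hold along the path\<close>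
  have sig_upto_eq: "sig_upto t w = (\<Sum>k\<le>length w. tpow P k w / fact k * s t ^ k)" if t: "t \<in> {a..b}" for t w
  proof -
    let ?p = "word w - (\<Sum>k\<le>length w. (tpow P k w / fact k) *\<^sub>R z ^ k)"
    have "?p \<in> curve_ideal" by (rule word_minus_powers_in_curve_ideal[OF z])
    then have "pairing (append_letter i (?p ^ N * q)) (sig_upto b) = 0" for i q
      using pairing_series_at_curve_ideal[OF append_letter_in_curve_ideal] exp by metis
    then have "pairing (?p ^ N) (sig_upto t) = 0"
      by (intro vanishing_on_path[OF \<open>a < b\<close> red _ t])
    moreover have "pairing (q ^ n) (sig_upto t) = pairing q (sig_upto t) ^ n" for q n
      by (induction n) (simp_all add: shuffle_identity[OF le t])
    ultimately have "pairing ?p (sig_upto t) = 0" by simp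
    then show ?thesis by (simp add: pairing_diff pairing_sum pairing_scale power[OF t])
  qed
  have "inj_on s {a..b}"
  proof (rule inj_onI)
    fix x y assume xy: "x \<in> {a..b}" "y \<in> {a..b}" "s x = s y"
    then have "sig_upto x = sig_upto y" by (simp add: fun_eq_iff sig_upto_eq)
    then show "x = y" using inj_on_sig_upto[OF red] xy by (meson inj_onD)
  qed
  moreover have "continuous_on {a..b} s"
    unfolding s_def[abs_def] by (intro controlled_continuous controlled_pairing le)
  moreover have "s a = 0" using z(2) by (simp add: s_def sig_upto_start[OF le])
  moreover have "s b = 1"
  proof -
    have "tpow P k w0 = (if k = 1 then P w0 else 0)" for k
      using power_pairing[OF z, of 1 k] w0(1) by (auto simp: z_def pairing_scale split: if_splits)
    then have "sig_upto b w0 = (\<Sum>k\<le>length w0. if k = 1 then P w0 else 0)"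
      unfolding exp[symmetric] series_at_def by (intro sum.cong) auto
    also have "\<dots> = P w0"
    proof -
      have "1 \<in> {..length w0}" using \<open>w0 \<noteq> []\<close> by (cases w0) auto
      then show ?thesis by (simp only: sum.delta finite_atMost if_True)
    qed
    finally show ?thesis using w0(1) by (simp add: s_eq)
  qed
  ultimately have s: "strict_mono_on {a..b} s" "bij_betw s {a..b} {0..1}"
    using strict_mono_if_injective[OF \<open>a < b\<close>] by blast+
  have "\<gamma> t = s t *\<^sub>R (\<chi> i. P [i]) + \<gamma> a" if t: "t \<in> {a..b}" for t
  proof -
    have "\<gamma> t $ i - \<gamma> a $ i = s t * P [i]" for i
    proof -
      have "tone [i] = 0" by (simp add: tone_def)
      then show ?thesis using sig_upto_letter[OF le t, of i] sig_upto_eq[OF t, of "[i]"] by (simp add: mult.commute)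
    qed
    then show ?thesis by (simp add: vec_eq_iff algebra_simps)
  qed
  with s show ?thesis by blast
qed

end

section \<open>The log-signature of a straight path\<close>

lemma tpow_tvec_Cons: "tpow (tvec v) (Suc n) (i # w) = v $ i * tpow (tvec v) n w"
proof -
  have "(\<lambda>u. tvec v (i # u)) = (\<lambda>u. v $ i * tone u)" by (simp add: tvec_def tone_def fun_eq_iff)
  then have "tprod (\<lambda>u. tvec v (i # u)) (tpow (tvec v) n) w = v $ i * tpow (tvec v) n w"
    using tprod_scale_left[of "v $ i" tone "tpow (tvec v) n" w] by simp
  then show ?thesis by (simp add: tprod_Cons) (simp add: tvec_def)
qed

lemma tpow_tvec_homogeneous: "length w \<noteq> n \<Longrightarrow> tpow (tvec v) n w = 0"
proof (induction n arbitrary: w)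
  case 0
  then show ?case by (simp add: tone_def)
next
  case (Suc n)
  show ?case
  proof (cases w)
    case Nil
    then show ?thesis by (simp add: tprod_Nil tvec_def)
  next
    case (Cons i u)
    then show ?thesis using Suc tpow_tvec_Cons[of v n i u] by (simp del: tpow.simps)
  qed
qed

lemma series_at_exp_tvec: "series_at (fps_exp 1) (tvec v) w = tpow (tvec v) (length w) w / fact (length w)"
proof -
  have "series_at (fps_exp 1) (tvec v) w
      = (\<Sum>n\<le>length w. if n = length w then tpow (tvec v) (length w) w / fact (length w) else 0)"
    unfolding series_at_def by (intro sum.cong) (auto simp: tpow_tvec_homogeneous)
  then show ?thesis by simp
qed

lemma lie_polynomial_tvec: "lie_polynomial (tvec v)"
proof -
  have zero: "tproj k (tvec v) = tzero" if "k \<noteq> 1" for k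
    using that by (auto simp: tproj_def tvec_def tzero_def fun_eq_iff)
  have one: "tproj 1 (tvec v) = tvec v" by (auto simp: tproj_def tvec_def fun_eq_iff)
  have "lie_homogeneous k (tproj k (tvec v))" for k
  proof (cases "k = 1")
    case True
    have "tvec v = (\<lambda>w. \<Sum>j<Suc 0. 1 * iter_bracket [v] w)" by simp
    then show ?thesis unfolding True one lie_homogeneous_def
      by (intro exI[of _ "Suc 0"] exI[of _ "\<lambda>_. 1"] exI[of _ "\<lambda>_. [v]"]) simp
  next
    case False
    then show ?thesis unfolding zero[OF False] lie_homogeneous_def
      by (intro exI[of _ 0]) (simp add: tzero_def)
  qed
  moreover have "finite {k. tproj k (tvec v) \<noteq> tzero}"
    by (rule finite_subset[of _ "{1}"]) (use zero in auto)
  ultimately show ?thesis using zero[of 0] by (simp add: lie_polynomial_def lie_series_def)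
qed

context controlled_path
begin

text \<open>If \<open>d\<gamma> = v ds\<close>, the iterated integrals over a word of length \<open>n\<close> are those of \<open>ds\<close>, which are
\<open>s\<^sup>n / n!\<close>, times a product of coordinates of \<open>v\<close>.\<close>

lemma signature_straight_path:
  assumes "a \<le> b" and line: "\<And>t. t \<in> {a..b} \<Longrightarrow> \<gamma> t = s t *\<^sub>R v + u" and s: "s a = 0" "s b = 1"
  shows "signature \<gamma> a b = series_at (fps_exp 1) (tvec v)"
proof -
  have "\<forall>t\<in>{a..b}. iter_integral \<gamma> a w t
      = tpow (tvec v) (length w) w * (s t ^ length w / fact (length w))" for w
  proof (induction w)
    case Nil
    show ?case by (simp add: tone_def)
  next
    case (Cons i w)
    let ?n = "length w" and ?c = "tpow (tvec v) (length w) w"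
    have "stieltjes a b (\<lambda>t. ?c * v $ i * (s t ^ Suc ?n / fact (Suc ?n)))
        (\<lambda>t. ?c * (s t ^ ?n / fact ?n)) (\<lambda>t. \<gamma> t $ i)"
    proof (cases "v $ i = 0")
      case True
      then show ?thesis unfolding stieltjes_def
        by (intro negligible_cong[OF negligible_zero]) (simp add: line)
    next
      case False
      have "controlled a b (\<lambda>t. (1 / v $ i) * (\<gamma> t $ i + - (u $ i)))"
        by (intro controlled_cmult controlled_add controlled controlled_const)
      then have cs: "controlled a b s"
        by (rule controlled_cong) (use False in \<open>simp add: line\<close>)
      have "negligible a b (\<lambda>x y t. (?c * v $ i) *
          (s t ^ Suc ?n / fact (Suc ?n) - s x ^ Suc ?n / fact (Suc ?n) - s y ^ ?n / fact ?n * (s t - s x)))"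
        by (rule negligible_cmult[OF stieltjes_power[OF cs \<open>a \<le> b\<close>, unfolded stieltjes_def]])
      then show ?thesis
        unfolding stieltjes_def
        by (rule negligible_cong) (simp add: line algebra_simps)
    qed
    moreover have "stieltjes a b (iter_integral \<gamma> a (i # w)) (\<lambda>t. ?c * (s t ^ ?n / fact ?n)) (\<lambda>t. \<gamma> t $ i)"
      by (rule stieltjes_cong[OF stieltjes_iter_integral[OF \<open>a \<le> b\<close>]]) (use Cons.IH in auto)
    ultimately have "iter_integral \<gamma> a (i # w) t - iter_integral \<gamma> a (i # w) a
        = ?c * v $ i * (s t ^ Suc ?n / fact (Suc ?n)) - ?c * v $ i * (s a ^ Suc ?n / fact (Suc ?n))"
      if "t \<in> {a..b}" for t
      using stieltjes_unique that by (metis (no_types, lifting) atLeastAtMost_iff)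
    moreover have "iter_integral \<gamma> a (i # w) a = 0"
      by (simp only: iter_integral_start[OF \<open>a \<le> b\<close>]) (simp add: tone_def)
    ultimately show ?case
      using s(1) tpow_tvec_Cons[of v ?n i w] by (simp del: iter_integral.simps tpow.simps fact_Suc)
  qed
  then have b: "iter_integral \<gamma> a w b = tpow (tvec v) (length w) w / fact (length w)" for w
    using \<open>a \<le> b\<close> s(2) by simp
  have rev: "tpow (tvec v) n (rev w) = tpow (tvec v) n w" for n w
  proof -
    have "(\<lambda>w. tvec v (rev w)) = tvec v"
      by (auto simp: tvec_def fun_eq_iff length_Suc_conv)
    then show ?thesis using tpow_rev[of "tvec v" n w] by simp
  qed
  show ?thesis by (rule ext) (simp add: signature_def b rev series_at_exp_tvec)
qed

lemma polynomial_if_straight: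
  assumes "a < b" and s: "strict_mono_on {a..b} s" "bij_betw s {a..b} {0..1}"
    and line: "\<And>t. t \<in> {a..b} \<Longrightarrow> \<gamma> t = s t *\<^sub>R v + u"
  shows "lie_polynomial (log_signature \<gamma> a b)"
proof -
  have img: "s ` {a..b} = {0..1}" using s(2) by (simp add: bij_betw_def)
  have mono: "s x \<le> s y" if "x \<in> {a..b}" "y \<in> {a..b}" "x \<le> y" for x y
    using strict_mono_onD[OF s(1) that(1,2)] that(3) by (cases "x = y") auto
  have ab: "a \<in> {a..b}" "b \<in> {a..b}" using \<open>a < b\<close> by auto
  have "0 \<in> s ` {a..b}" "1 \<in> s ` {a..b}" unfolding img by auto
  then obtain x y where "x \<in> {a..b}" "s x = 0" "y \<in> {a..b}" "s y = 1" by auto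
  moreover have "s a \<in> {0..1}" "s b \<in> {0..1}" using img ab by blast+
  ultimately have "s a = 0" "s b = 1" using mono[of a x] mono[of y b] ab by auto
  then have "signature \<gamma> a b = series_at (fps_exp 1) (tvec v)"
    using \<open>a < b\<close> line by (intro signature_straight_path[where s = s and u = u]) auto
  then have "log_signature \<gamma> a b = tvec v"
    using tlog_exp[of "tvec v"] by (simp add: log_signature_def tvec_def)
  then show ?thesis by (simp add: lie_polynomial_tvec)
qed

end

section \<open>Paths with polynomial log-signature\<close>

theorem theorem1p4:
  fixes \<gamma> :: "real \<Rightarrow> real ^ 'd" and t0 t1 :: real
  assumes "t0 < t1"
    and "rectifiable \<gamma> t0 t1"
    and "reduced_path \<gamma> t0 t1"
  shows "lie_polynomial (log_signature \<gamma> t0 t1) \<longleftrightarrow>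
    (\<exists>(a :: real ^ 'd) (b :: real ^ 'd) (\<tau> :: real \<Rightarrow> real).
        strict_mono_on {t0..t1} \<tau> \<and> bij_betw \<tau> {t0..t1} {0..1} \<and>
        (\<forall>t\<in>{t0..t1}. \<gamma> t = \<tau> t *\<^sub>R a + b))"
proof -
  have cont: "continuous_on {t0..t1} \<gamma>" and bv: "bounded_variation_on \<gamma> t0 t1"
    using assms(2) by (simp_all add: rectifiable_def)
  obtain W where W: "control W"
    and incr: "\<And>s t. \<lbrakk>t0 \<le> s; s \<le> t; t \<le> t1\<rbrakk> \<Longrightarrow> norm (\<gamma> t - \<gamma> s) \<le> W t - W s"
    using bounded_variation_control[OF bv] assms(1) by (metis less_imp_le)
  interpret control W by (rule W)
  interpret controlled_path W \<gamma> t0 t1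
  proof
    fix i
    have "\<bar>\<gamma> t $ i - \<gamma> s $ i\<bar> \<le> 1 * (W t - W s)" if "t0 \<le> s" "s \<le> t" "t \<le> t1" for s t
      using component_le_norm_cart[of "\<gamma> t - \<gamma> s" i] incr[OF that] by simp
    moreover have "continuous_on {t0..t1} (\<lambda>t. \<gamma> t $ i)" by (intro continuous_intros cont)
    ultimately show "controlled t0 t1 (\<lambda>t. \<gamma> t $ i)"
      unfolding controlled_def by (intro conjI exI[of _ 1]) auto
  qed
  show ?thesis
  proof
    assume "lie_polynomial (log_signature \<gamma> t0 t1)"
    then show "\<exists>a b \<tau>. strict_mono_on {t0..t1} \<tau> \<and> bij_betw \<tau> {t0..t1} {0..1} \<and>
        (\<forall>t\<in>{t0..t1}. \<gamma> t = \<tau> t *\<^sub>R a + b)"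
      by (rule straight_if_polynomial[OF assms(1,3)])
  next
    assume "\<exists>a b \<tau>. strict_mono_on {t0..t1} \<tau> \<and> bij_betw \<tau> {t0..t1} {0..1} \<and>
        (\<forall>t\<in>{t0..t1}. \<gamma> t = \<tau> t *\<^sub>R a + b)"
    then show "lie_polynomial (log_signature \<gamma> t0 t1)"
      using polynomial_if_straight[OF assms(1)] by blast
  qed
qed

end
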